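(* Let $d\ge 2$ and $\beta>0$ arbitrary, and consider the random field model on $B_n$ described in the context, where the field parameter $h=h_n$ is allowed to depend on $n$. If $h_n\to 0$ as $n\to\infty$, then for any metric on probability measures on $\mathbb{R}$ that metrizes weak convergence, the distance between the quenched law of $R_{1,2}$ under this model (its law conditional on $(J_i)$) and the law of $R_{1,2}$ under the ordinary Ising model on $B_n$ at the same inverse temperature $\beta$ and free boundary condition (i.e. the case $h=0$) tends to zero in probability as $n\to\infty$. On the other hand, if $|h_n|\to\infty$ as $n\to\infty$ and the $J_i$'s are i.i.d. standard Gaussian random variables, then $\mathbb{E}\langle (R_{1,2}-\langle R_{1,2}\rangle)^2\rangle\to 0$ as $n\to\infty$.
   Context: $B_n=\{-n,\ldots,n\}^d$, $E_n$ its undirected nearest-neighbor edges, $\Sigma_n=\{-1,1\}^{B_n}$. $(J_i)_{i\in B_n}$ are i.i.d. real random variables with mean $0$, variance $1$, and moment generating function finite in an open neighborhood of the origin. Hamiltonian $H_n(\sigma)=-\sum_{\{i,j\}\in E_n}\sigma_i\sigma_j-\frac{h_n}{\sqrt{|B_n|}}\sum_{i\in B_n}J_i\sigma_i$; Gibbs measure at inverse temperature $\beta$ with mass proportional to $e^{-\beta H_n(\sigma)}$. $\langle\cdot\rangle$ is Gibbs expectation for fixed $(J_i)$ (for functions of independent replicas $\sigma^1,\sigma^2$), $\mathbb{E}$ the expectation over $(J_i)$, and $R_{1,2}=\frac{1}{|B_n|}\sum_i\sigma^1_i\sigma^2_i$. *)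

theory Defs
  imports "HOL-Probability.Probability"
begin

definition box :: "nat \<Rightarrow> nat \<Rightarrow> int list set" where
  "box d n = {x. length x = d \<and> (\<forall>i<d. - int n \<le> x ! i \<and> x ! i \<le> int n)}"

definition edges :: "nat \<Rightarrow> nat \<Rightarrow> int list set set" where
  "edges d n = {{x, y} | x y. x \<in> box d n \<and> y \<in> box d n \<and> (\<Sum>i<d. \<bar>x ! i - y ! i\<bar>) = 1}"

definition configs :: "nat \<Rightarrow> nat \<Rightarrow> (int list \<Rightarrow> real) set" where
  "configs d n = (box d n \<rightarrow>\<^sub>E {-1, 1})"

definition hamiltonian :: "nat \<Rightarrow> nat \<Rightarrow> real \<Rightarrow> (int list \<Rightarrow> real) \<Rightarrow> (int list \<Rightarrow> real) \<Rightarrow> real" where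
  "hamiltonian d n h J \<sigma> =
     - (\<Sum>e\<in>edges d n. \<Prod>v\<in>e. \<sigma> v)
     - h / sqrt (real (card (box d n))) * (\<Sum>i\<in>box d n. J i * \<sigma> i)"

definition partition_fn :: "nat \<Rightarrow> real \<Rightarrow> nat \<Rightarrow> real \<Rightarrow> (int list \<Rightarrow> real) \<Rightarrow> real" where
  "partition_fn d \<beta> n h J = (\<Sum>\<sigma>\<in>configs d n. exp (- \<beta> * hamiltonian d n h J \<sigma>))"

definition gibbs :: "nat \<Rightarrow> real \<Rightarrow> nat \<Rightarrow> real \<Rightarrow> (int list \<Rightarrow> real) \<Rightarrow> (int list \<Rightarrow> real) \<Rightarrow> real" where
  "gibbs d \<beta> n h J \<sigma> = exp (- \<beta> * hamiltonian d n h J \<sigma>) / partition_fn d \<beta> n h J"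

definition overlap :: "nat \<Rightarrow> nat \<Rightarrow> (int list \<Rightarrow> real) \<Rightarrow> (int list \<Rightarrow> real) \<Rightarrow> real" where
  "overlap d n \<sigma>1 \<sigma>2 = (\<Sum>i\<in>box d n. \<sigma>1 i * \<sigma>2 i) / real (card (box d n))"

definition gibbs2 :: "nat \<Rightarrow> real \<Rightarrow> nat \<Rightarrow> real \<Rightarrow> (int list \<Rightarrow> real)
    \<Rightarrow> ((int list \<Rightarrow> real) \<Rightarrow> (int list \<Rightarrow> real) \<Rightarrow> real) \<Rightarrow> real" where
  "gibbs2 d \<beta> n h J f =
     (\<Sum>\<sigma>1\<in>configs d n. \<Sum>\<sigma>2\<in>configs d n. gibbs d \<beta> n h J \<sigma>1 * gibbs d \<beta> n h J \<sigma>2 * f \<sigma>1 \<sigma>2)"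

definition gibbs_pair_measure :: "nat \<Rightarrow> real \<Rightarrow> nat \<Rightarrow> real \<Rightarrow> (int list \<Rightarrow> real)
    \<Rightarrow> ((int list \<Rightarrow> real) \<times> (int list \<Rightarrow> real)) measure" where
  "gibbs_pair_measure d \<beta> n h J =
     density (count_space (configs d n \<times> configs d n))
       (\<lambda>(\<sigma>1, \<sigma>2). ennreal (gibbs d \<beta> n h J \<sigma>1 * gibbs d \<beta> n h J \<sigma>2))"

definition overlap_law :: "nat \<Rightarrow> real \<Rightarrow> nat \<Rightarrow> real \<Rightarrow> (int list \<Rightarrow> real) \<Rightarrow> real measure" where
  "overlap_law d \<beta> n h J = distr (gibbs_pair_measure d \<beta> n h J) borel (\<lambda>(\<sigma>1, \<sigma>2). overlap d n \<sigma>1 \<sigma>2)"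

definition ising_overlap_law :: "nat \<Rightarrow> real \<Rightarrow> nat \<Rightarrow> real measure" where
  "ising_overlap_law d \<beta> n = overlap_law d \<beta> n 0 (\<lambda>_. 0)"

definition metrizes_weak_conv :: "(real measure \<Rightarrow> real measure \<Rightarrow> real) \<Rightarrow> bool" where
  "metrizes_weak_conv \<rho> \<longleftrightarrow>
     (\<forall>\<mu> \<nu>. real_distribution \<mu> \<longrightarrow> real_distribution \<nu> \<longrightarrow>
        0 \<le> \<rho> \<mu> \<nu> \<and> (\<rho> \<mu> \<nu> = 0 \<longleftrightarrow> \<mu> = \<nu>) \<and> \<rho> \<mu> \<nu> = \<rho> \<nu> \<mu>) \<and>
     (\<forall>\<mu> \<nu> \<xi>. real_distribution \<mu> \<longrightarrow> real_distribution \<nu> \<longrightarrow> real_distribution \<xi> \<longrightarrow>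
        \<rho> \<mu> \<xi> \<le> \<rho> \<mu> \<nu> + \<rho> \<nu> \<xi>) \<and>
     (\<forall>\<mu>s \<mu>. (\<forall>k. real_distribution (\<mu>s k)) \<longrightarrow> real_distribution \<mu> \<longrightarrow>
        ((\<lambda>k. \<rho> (\<mu>s k) \<mu>) \<longlonglongrightarrow> 0 \<longleftrightarrow> weak_conv_m \<mu>s \<mu>))"

definition disorder :: "nat \<Rightarrow> nat \<Rightarrow> real measure \<Rightarrow> (int list \<Rightarrow> real) measure" where
  "disorder d n D = PiM (box d n) (\<lambda>_. D)"

definition std_gaussian :: "real measure" where
  "std_gaussian = density lborel std_normal_density"

end

theory Submission
  imports Defs "HOL-Real_Asymp.Real_Asymp"
begin

text \<open>
  Small field: with \<open>Y(\<sigma>) = \<beta> h / \<surd>N \<Sum> J\<^sub>i \<sigma>\<^sub>i\<close>, the Gibbs measure has density \<open>e\<^sup>Y / \<langle>e\<^sup>Y\<rangle>\<close> with respect to the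
  Ising measure, and independence of the \<open>J\<^sub>i\<close> gives \<open>E (e\<^sup>Y - 1)\<^sup>2 \<le> exp (4 C \<beta>\<^sup>2 h\<^sup>2) - 1\<close> for each fixed \<open>\<sigma>\<close>.
  Hence the total variation distance of the two Gibbs measures tends to 0 in probability.

  Large field: \<open>\<langle>(R - \<langle>R\<rangle>)\<^sup>2\<rangle> = N\<^sup>-\<^sup>2 \<Sum>\<^sub>i\<^sub>j (\<langle>\<sigma>\<^sub>i\<sigma>\<^sub>j\<rangle>\<^sup>2 - \<langle>\<sigma>\<^sub>i\<rangle>\<^sup>2\<langle>\<sigma>\<^sub>j\<rangle>\<^sup>2) \<le> 2 N\<^sup>-\<^sup>2 \<Sum>\<^sub>i\<^sub>j \<langle>\<sigma>\<^sub>i;\<sigma>\<^sub>j\<rangle>\<close>, because the FKG inequality makes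
  all covariances nonnegative. Since \<open>\<partial>\<langle>\<sigma>\<^sub>i\<rangle>/\<partial>J\<^sub>j = \<beta> h / \<surd>N \<langle>\<sigma>\<^sub>i;\<sigma>\<^sub>j\<rangle>\<close>, Gaussian integration by parts turns the expected
  sum into \<open>\<surd>N / (\<beta> h) E (\<Sum> J\<^sub>j) (\<Sum> \<langle>\<sigma>\<^sub>i\<rangle>)\<close>, and \<open>E \<bar>\<Sum> J\<^sub>j\<bar> \<le> \<surd>N\<close> yields the bound \<open>2 / (\<beta> \<bar>h\<bar>)\<close>.
\<close>

section \<open>The FKG inequality\<close>

text \<open>The arithmetic of the inductive step of the FKG inequality. The indices 0 and 1 stand
  for the absence and presence of the site being split off; \<open>Z\<close> is the mass of a block,
  and \<open>F\<close>, \<open>G\<close>, \<open>P\<close> are the unnormalised sums of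
  \<open>f\<close>, \<open>g\<close> and \<open>f * g\<close> over it. Both block means increase
  from 0 to 1, so the two-point Chebyshev inequality adds the contribution between blocks to those
  within them.\<close>

lemma chebyshev_two_blocks:
  fixes Z0 Z1 F0 F1 G0 G1 P0 P1 :: real
  assumes Z: "0 < Z0" "0 < Z1"
    and P: "F0 * G0 \<le> Z0 * P0" "F1 * G1 \<le> Z1 * P1"
    and F: "F0 * Z1 \<le> Z0 * F1" and G: "G0 * Z1 \<le> Z0 * G1"
  shows "(F0 + F1) * (G0 + G1) \<le> (Z0 + Z1) * (P0 + P1)"
proof -
  define a0 a1 b0 b1 where "a0 = F0 / Z0" "a1 = F1 / Z1" "b0 = G0 / Z0" "b1 = G1 / Z1"
  then have eqs: "F0 = Z0 * a0" "F1 = Z1 * a1" "G0 = Z0 * b0" "G1 = Z1 * b1"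
    using Z by auto
  have "a0 \<le> a1" "b0 \<le> b1"
    using F G Z unfolding eqs by (auto simp: ac_simps)
  then have "0 \<le> (Z0 * Z1) * ((a1 - a0) * (b1 - b0))"
    using Z by simp
  \<comment> \<open>The right side minus the left side is exactly the product just shown to be
    nonnegative.\<close>
  then have "(F0 + F1) * (G0 + G1) \<le> (Z0 + Z1) * (Z0 * a0 * b0 + Z1 * a1 * b1)"
    unfolding eqs by (simp add: algebra_simps)
  also have "Z0 * a0 * b0 \<le> P0" "Z1 * a1 * b1 \<le> P1"
    using P Z unfolding eqs by (auto simp: ac_simps)
  then have "(Z0 + Z1) * (Z0 * a0 * b0 + Z1 * a1 * b1) \<le> (Z0 + Z1) * (P0 + P1)"
    using Z by (intro mult_left_mono) auto
  finally show ?thesis .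
qed

lemma sum_Pow_insert:
  fixes f :: "'a set \<Rightarrow> 'b :: comm_monoid_add"
  assumes "finite V" "k \<notin> V"
  shows "sum f (Pow (insert k V)) = (\<Sum>A\<in>Pow V. f A) + (\<Sum>A\<in>Pow V. f (insert k A))"
proof -
  have "inj_on (insert k) (Pow V)"
    using assms by (auto simp: inj_on_def)
  moreover have "Pow V \<inter> insert k ` Pow V = {}"
    using assms by auto
  ultimately show ?thesis
    using assms by (simp add: Pow_insert sum.union_disjoint sum.reindex)
qed

text \<open>Induction on the ground set, splitting subsets according to whether they contain
  \<open>k\<close>. The lattice condition restricts to each block. The weights are left unnormalised
  because the blocks of a probability weight do not have mass 1; their strict positivity allows
  division by \<open>w A\<close>.\<close>

theorem fkg_inequality:
  fixes w f g :: "'a set \<Rightarrow> real"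
  assumes "finite V"
    and "\<And>A. A \<subseteq> V \<Longrightarrow> 0 < w A"
    and "\<And>A B. A \<subseteq> V \<Longrightarrow> B \<subseteq> V \<Longrightarrow> w A * w B \<le> w (A \<union> B) * w (A \<inter> B)"
    and "mono_on (Pow V) f" "mono_on (Pow V) g"
  shows "(\<Sum>A\<in>Pow V. w A * f A) * (\<Sum>A\<in>Pow V. w A * g A)
    \<le> (\<Sum>A\<in>Pow V. w A) * (\<Sum>A\<in>Pow V. w A * (f A * g A))"
  using assms
proof (induction V arbitrary: w f g rule: finite_induct)
  case empty
  then show ?case by simp
next
  case (insert k V)
  note pos = insert.prems(1) and sm = insert.prems(2)
  let ?S = "\<lambda>h. \<Sum>A\<in>Pow V. h A"
  let ?i = "\<lambda>h A. h (insert k A)"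
  have sub: "mono_on (Pow V) h" "mono_on (Pow V) (?i h)" if "mono_on (Pow (insert k V)) h" for h :: "'a set \<Rightarrow> real"
    using that by (auto simp: mono_on_def insert_mono subset_insertI2)
  have posV: "0 < w A" "0 < w (insert k A)" if "A \<subseteq> V" for A
    using that by (auto intro!: pos)
  have smV: "w A * w B \<le> w (A \<union> B) * w (A \<inter> B)"
      "?i w A * ?i w B \<le> ?i w (A \<union> B) * ?i w (A \<inter> B)"
    if "A \<subseteq> V" "B \<subseteq> V" for A B
    using sm[of A B] sm[of "insert k A" "insert k B"] that by auto
  \<comment> \<open>This is the lattice condition for \<open>insert k A\<close> and
    \<open>B\<close>: the union is \<open>insert k B\<close>, and the intersection is
    \<open>A\<close> because \<open>k\<close> is not in \<open>B\<close>.\<close>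
  have ratio: "mono_on (Pow V) (\<lambda>A. ?i w A / w A)"
  proof (rule mono_onI)
    fix A B assume *: "A \<in> Pow V" "B \<in> Pow V" "A \<subseteq> B"
    then have "insert k A \<union> B = insert k B" "insert k A \<inter> B = A"
      using \<open>k \<notin> V\<close> by auto
    then have "?i w A * w B \<le> ?i w B * w A"
      using sm[of "insert k A" B] * by auto
    then show "?i w A / w A \<le> ?i w B / w B"
      using posV * by (simp add: field_simps)
  qed
  \<comment> \<open>Conditioning on \<open>k\<close> being present raises the mean of \<open>h\<close>: it tilts the weight by the increasing function
    \<open>ratio\<close>, so the induction hypothesis applies.\<close>
  have cond: "?S (\<lambda>A. w A * h A) * ?S (?i w) \<le> ?S w * ?S (\<lambda>A. ?i w A * ?i h A)"
    if h: "mono_on (Pow (insert k V)) h" for h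
  proof -
    have "?S (\<lambda>A. w A * h A) * ?S (?i w) = ?S (\<lambda>A. w A * h A) * ?S (\<lambda>A. w A * (?i w A / w A))"
      using posV by (intro arg_cong2[where f="(*)"] sum.cong) (auto simp: less_imp_neq[symmetric])
    also have "\<dots> \<le> ?S w * ?S (\<lambda>A. w A * (h A * (?i w A / w A)))"
      by (rule insert.IH) (use posV smV sub h ratio in auto)
    also have "\<dots> \<le> ?S w * ?S (\<lambda>A. ?i w A * ?i h A)"
    proof (intro mult_left_mono sum_mono sum_nonneg)
      fix A assume A: "A \<in> Pow V"
      have "h A \<le> ?i h A"
        using h A by (intro mono_onD[OF h]) auto
      moreover have "w A * (h A * (?i w A / w A)) = ?i w A * h A"
        using posV[of A] A by (simp add: field_simps)
      ultimately show "w A * (h A * (?i w A / w A)) \<le> ?i w A * ?i h A"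
        using posV[of A] A by simp
    qed (use posV in \<open>auto intro: less_imp_le\<close>)
    finally show ?thesis .
  qed
  show ?case
    unfolding sum_Pow_insert[OF insert.hyps]
  proof (rule chebyshev_two_blocks)
    show "0 < ?S w" "0 < ?S (?i w)"
      using posV insert.hyps by (auto intro!: sum_pos)
    show "?S (\<lambda>A. w A * f A) * ?S (\<lambda>A. w A * g A) \<le> ?S w * ?S (\<lambda>A. w A * (f A * g A))"
      by (rule insert.IH) (use posV smV sub insert.prems in auto)
    show "?S (\<lambda>A. ?i w A * ?i f A) * ?S (\<lambda>A. ?i w A * ?i g A)
        \<le> ?S (?i w) * ?S (\<lambda>A. ?i w A * (?i f A * ?i g A))"
      by (rule insert.IH) (use posV smV sub insert.prems in auto)
  qed (use cond insert.prems in auto)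
qed

section \<open>Boxes, spin configurations and Gibbs averages\<close>

lemma finite_box [simp, intro]: "finite (box d n)"
proof (rule finite_subset)
  show "box d n \<subseteq> {x. set x \<subseteq> {- int n..int n} \<and> length x = d}"
    by (auto simp: box_def in_set_conv_nth)
qed (rule finite_lists_length_eq, simp)

lemma card_box_pos: "0 < card (box d n)"
proof -
  have "replicate d 0 \<in> box d n"
    by (simp add: box_def)
  then show ?thesis
    by (auto simp: card_gt_0_iff)
qed

lemma edgesE:
  assumes "e \<in> edges d n"
  obtains x y where "e = {x, y}" "x \<in> box d n" "y \<in> box d n" "x \<noteq> y"
proof -
  from assms obtain x y where e: "e = {x, y}" "x \<in> box d n" "y \<in> box d n"
      "(\<Sum>i<d. \<bar>x ! i - y ! i\<bar>) = 1"
    by (auto simp: edges_def)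
  then have "x \<noteq> y" by auto
  with e show ?thesis by (intro that)
qed

lemma finite_configs [simp, intro]: "finite (configs d n)"
  unfolding configs_def by (rule finite_PiE) auto

lemma configs_nonempty: "configs d n \<noteq> {}"
  by (auto simp: configs_def PiE_eq_empty_iff)

lemma configs_spin: "\<sigma> \<in> configs d n \<Longrightarrow> i \<in> box d n \<Longrightarrow> \<sigma> i = -1 \<or> \<sigma> i = 1"
  by (auto simp: configs_def PiE_def Pi_def)

text \<open>Encodes a configuration by its set of plus spins, which turns the pointwise order of
  spins into inclusion and makes \<open>fkg_inequality\<close> applicable. Outside \<open>V\<close>
  the restricted function is \<open>undefined\<close>, as membership in the extensional product
  demands.\<close>

lemma bij_betw_spins:
  "bij_betw (\<lambda>A. \<lambda>v\<in>V. if v \<in> A then 1 else - 1 :: real) (Pow V) (V \<rightarrow>\<^sub>E {-1, 1})"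
proof (rule bij_betwI[where g = "\<lambda>\<sigma>. {v \<in> V. \<sigma> v = 1}"])
  fix \<sigma> :: "'a \<Rightarrow> real" assume \<sigma>: "\<sigma> \<in> V \<rightarrow>\<^sub>E {-1, 1}"
  show "(\<lambda>v\<in>V. if v \<in> {v \<in> V. \<sigma> v = 1} then 1 else - 1) = \<sigma>"
  proof
    fix v show "(\<lambda>v\<in>V. if v \<in> {v \<in> V. \<sigma> v = 1} then 1 else - 1) v = \<sigma> v"
      using \<sigma> by (cases "v \<in> V") (auto simp: PiE_def Pi_def extensional_def)
  qed
qed auto

definition gibbs_mean :: "nat \<Rightarrow> real \<Rightarrow> nat \<Rightarrow> real \<Rightarrow> (int list \<Rightarrow> real)
    \<Rightarrow> ((int list \<Rightarrow> real) \<Rightarrow> real) \<Rightarrow> real" where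
  "gibbs_mean d \<beta> n h J f = (\<Sum>\<sigma>\<in>configs d n. gibbs d \<beta> n h J \<sigma> * f \<sigma>)"

lemma partition_fn_pos: "0 < partition_fn d \<beta> n h J"
  unfolding partition_fn_def using configs_nonempty by (intro sum_pos) auto

lemma gibbs_pos: "0 < gibbs d \<beta> n h J \<sigma>"
  by (simp add: gibbs_def partition_fn_pos)

lemma sum_gibbs: "(\<Sum>\<sigma>\<in>configs d n. gibbs d \<beta> n h J \<sigma>) = 1"
  using partition_fn_pos[of d \<beta> n h J]
  by (simp add: gibbs_def sum_divide_distrib[symmetric] partition_fn_def)

text \<open>The ferromagnetic edge terms are supermodular in the set of plus spins and the field
  term is modular whatever the signs of \<open>h\<close> and \<open>J\<close>. For nonnegative
  \<open>\<beta>\<close> the Gibbs weight therefore satisfies the lattice condition, and each spin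
  is an increasing function.\<close>

theorem spin_correlation_nonneg:
  assumes "0 \<le> \<beta>" "i \<in> box d n" "j \<in> box d n"
  shows "gibbs_mean d \<beta> n h J (\<lambda>\<sigma>. \<sigma> i) * gibbs_mean d \<beta> n h J (\<lambda>\<sigma>. \<sigma> j)
    \<le> gibbs_mean d \<beta> n h J (\<lambda>\<sigma>. \<sigma> i * \<sigma> j)"
proof -
  let ?V = "box d n"
  let ?s = "\<lambda>A. \<lambda>v\<in>?V. if v \<in> A then 1 else - 1 :: real"
  let ?w = "\<lambda>A. gibbs d \<beta> n h J (?s A)"
  have mean: "gibbs_mean d \<beta> n h J f = (\<Sum>A\<in>Pow ?V. ?w A * f (?s A))" for f
    unfolding gibbs_mean_def configs_def
    by (rule sum.reindex_bij_betw[OF bij_betw_spins, symmetric])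
  have total: "(\<Sum>A\<in>Pow ?V. ?w A) = 1"
    using mean[of "\<lambda>_. 1"] by (simp add: gibbs_mean_def sum_gibbs)
  \<comment> \<open>On the two endpoints of an edge either the traces of \<open>A\<close> and
    \<open>B\<close> are comparable, and equality holds, or they are the two different singletons,
    and the sides are -2 and 2.\<close>
  have edge: "(\<Prod>v\<in>e. ?s A v) + (\<Prod>v\<in>e. ?s B v)
      \<le> (\<Prod>v\<in>e. ?s (A \<union> B) v) + (\<Prod>v\<in>e. ?s (A \<inter> B) v)" if "e \<in> edges d n" for e A B
    using that by (elim edgesE) simp
  have site: "?s A v + ?s B v = ?s (A \<union> B) v + ?s (A \<inter> B) v" for A B v
    by (cases "v \<in> ?V") auto
  have field: "(\<Sum>i\<in>?V. J i * ?s A i) + (\<Sum>i\<in>?V. J i * ?s B i)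
      = (\<Sum>i\<in>?V. J i * ?s (A \<union> B) i) + (\<Sum>i\<in>?V. J i * ?s (A \<inter> B) i)" for A B
    unfolding sum.distrib[symmetric] distrib_left[symmetric] by (intro sum.cong refl arg_cong2[where f="(*)"] site)
  have supermodular: "?w A * ?w B \<le> ?w (A \<union> B) * ?w (A \<inter> B)" for A B
  proof -
    let ?H = "\<lambda>A. hamiltonian d n h J (?s A)"
    have "(\<Sum>e\<in>edges d n. \<Prod>v\<in>e. ?s A v) + (\<Sum>e\<in>edges d n. \<Prod>v\<in>e. ?s B v)
        \<le> (\<Sum>e\<in>edges d n. \<Prod>v\<in>e. ?s (A \<union> B) v) + (\<Sum>e\<in>edges d n. \<Prod>v\<in>e. ?s (A \<inter> B) v)"
      unfolding sum.distrib[symmetric] by (intro sum_mono edge)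
    then have "?H (A \<union> B) + ?H (A \<inter> B) \<le> ?H A + ?H B"
      using arg_cong[OF field[of A B], of "\<lambda>x. h / sqrt (real (card ?V)) * x"]
      by (simp add: hamiltonian_def distrib_left)
    then have "\<beta> * (?H (A \<union> B) + ?H (A \<inter> B)) \<le> \<beta> * (?H A + ?H B)"
      using assms by (intro mult_left_mono)
    then have "exp (- \<beta> * ?H A) * exp (- \<beta> * ?H B) \<le> exp (- \<beta> * ?H (A \<union> B)) * exp (- \<beta> * ?H (A \<inter> B))"
      by (simp add: exp_add[symmetric] algebra_simps)
    then show ?thesis
      using partition_fn_pos[of d \<beta> n h J] by (simp add: gibbs_def divide_right_mono)
  qed
  have "(\<Sum>A\<in>Pow ?V. ?w A * ?s A i) * (\<Sum>A\<in>Pow ?V. ?w A * ?s A j)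
      \<le> (\<Sum>A\<in>Pow ?V. ?w A) * (\<Sum>A\<in>Pow ?V. ?w A * (?s A i * ?s A j))"
    by (rule fkg_inequality) (use supermodular assms in \<open>auto simp: gibbs_pos mono_on_def\<close>)
  then show ?thesis
    by (simp only: mean total mult_1)
qed

section \<open>Gaussian integration by parts\<close>

lemma prob_space_std_gaussian: "prob_space std_gaussian"
  unfolding std_gaussian_def by (rule prob_space_normal_density) simp

lemma sets_std_gaussian [measurable_cong, simp]: "sets std_gaussian = sets borel"
  by (simp add: std_gaussian_def)

lemma has_bochner_integral_std_gaussian_iff:
  fixes f :: "real \<Rightarrow> real"
  assumes [measurable]: "f \<in> borel_measurable borel"
  shows "has_bochner_integral std_gaussian f c \<longleftrightarrow>
    has_bochner_integral lborel (\<lambda>x. std_normal_density x * f x) c"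
  unfolding std_gaussian_def has_bochner_integral_iff
  by (simp add: integrable_density integral_density)

lemma std_gaussian_moments:
  "has_bochner_integral std_gaussian (\<lambda>x. x) 0"
  "has_bochner_integral std_gaussian (\<lambda>x. x\<^sup>2) 1"
  using std_normal_moment_odd[of 0] std_normal_moment_even[of 1]
  by (simp_all add: has_bochner_integral_std_gaussian_iff)

text \<open>Stein's identity. The density \<open>p\<close> satisfies \<open>p' = - x p\<close>, so
  \<open>p f' - x p f\<close> is the derivative of \<open>p f\<close>, which vanishes at both
  infinities because \<open>f\<close> is bounded. The fundamental theorem of calculus on the whole
  line then gives integral zero.\<close>

lemma std_gaussian_integration_by_parts:
  fixes f f' :: "real \<Rightarrow> real"
  assumes deriv: "\<And>x. (f has_real_derivative f' x) (at x)"
    and cont: "\<And>x. isCont f' x"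
    and bound: "\<And>x. \<bar>f x\<bar> \<le> B" "\<And>x. \<bar>f' x\<bar> \<le> B'"
  shows "(\<integral>x. x * f x \<partial>std_gaussian) = (\<integral>x. f' x \<partial>std_gaussian)"
proof -
  let ?p = std_normal_density
  have [measurable]: "f \<in> borel_measurable borel" "f' \<in> borel_measurable borel"
    using deriv cont by (auto intro!: borel_measurable_continuous_onI
        simp: continuous_on_eq_continuous_at DERIV_isCont[OF deriv])
  have p': "(?p has_real_derivative - x * ?p x) (at x)" for x
    unfolding std_normal_density_def
    by (auto intro!: derivative_eq_intros simp: field_simps)
  have p_lim: "(?p \<longlongrightarrow> 0) at_top" "(?p \<longlongrightarrow> 0) at_bot"
    unfolding std_normal_density_def by real_asymp+
  have lim: "((\<lambda>x. ?p x * f x) \<longlongrightarrow> 0) F" if "(?p \<longlongrightarrow> 0) F" for F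
  proof (rule Lim_null_comparison)
    show "\<forall>\<^sub>F x in F. norm (?p x * f x) \<le> ?p x * B"
      using bound by (auto intro!: always_eventually mult_left_mono simp: abs_mult)
    show "((\<lambda>x. ?p x * B) \<longlongrightarrow> 0) F"
      using tendsto_mult_right[OF that, of B] by simp
  qed
  have int: "integrable lborel (\<lambda>x. ?p x * f' x)" "integrable lborel (\<lambda>x. ?p x * (x * f x))"
  proof -
    have 0: "0 \<le> B" "0 \<le> B'"
      using bound[of 0] by linarith+
    show "integrable lborel (\<lambda>x. ?p x * f' x)"
    proof (rule Bochner_Integration.integrable_bound)
      \<comment> \<open>The power \<open>x ^ 0\<close> only brings the dominating function into the
        shape of \<open>integrable_std_normal_moment\<close>.\<close>
      show "integrable lborel (\<lambda>x. ?p x * x ^ 0 * B')"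
        by (intro integrable_mult_left integrable_std_normal_moment)
      show "AE x in lborel. norm (?p x * f' x) \<le> norm (?p x * x ^ 0 * B')"
        using bound 0 by (auto simp: abs_mult intro!: mult_left_mono)
    qed simp
    show "integrable lborel (\<lambda>x. ?p x * (x * f x))"
    proof (rule Bochner_Integration.integrable_bound)
      show "integrable lborel (\<lambda>x. ?p x * x ^ 1 * B)"
        by (intro integrable_mult_left integrable_std_normal_moment)
      show "AE x in lborel. norm (?p x * (x * f x)) \<le> norm (?p x * x ^ 1 * B)"
        using bound 0 by (auto simp: abs_mult mult.assoc intro!: mult_left_mono)
    qed simp
  qed
  have "(LBINT x=-\<infinity>..\<infinity>. ?p x * f' x - ?p x * (x * f x)) = 0 - 0"
  proof (rule interval_integral_FTC_integrable[where F = "\<lambda>x. ?p x * f x"])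
    show "((\<lambda>x. ?p x * f x) has_vector_derivative ?p x * f' x - ?p x * (x * f x)) (at x)" for x
      unfolding has_real_derivative_iff_has_vector_derivative[symmetric]
      by (rule derivative_eq_intros p' deriv refl)+ (simp add: algebra_simps)
    show "isCont (\<lambda>x. ?p x * f' x - ?p x * (x * f x)) x" for x
      by (intro continuous_intros cont DERIV_isCont[OF p'] DERIV_isCont[OF deriv])
    show "set_integrable lborel (einterval (-\<infinity>) \<infinity>) (\<lambda>x. ?p x * f' x - ?p x * (x * f x))"
      using int by (simp add: set_integrable_def einterval_def)
    show "(((\<lambda>x. ?p x * f x) \<circ> real_of_ereal) \<longlongrightarrow> 0) (at_right (-\<infinity>))"
      "(((\<lambda>x. ?p x * f x) \<circ> real_of_ereal) \<longlongrightarrow> 0) (at_left \<infinity>)"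
      using lim p_lim by (simp_all add: ereal_tendsto_simps)
  qed simp
  then have "(\<integral>x. ?p x * f' x - ?p x * (x * f x) \<partial>lborel) = 0"
    by (simp add: interval_lebesgue_integral_def set_lebesgue_integral_def einterval_def)
  then have "(\<integral>x. ?p x * (x * f x) \<partial>lborel) = (\<integral>x. ?p x * f' x \<partial>lborel)"
    using int by simp
  then show ?thesis
    unfolding std_gaussian_def by (simp add: integral_density)
qed

lemma integral_PiM_component:
  fixes f :: "'a \<Rightarrow> real"
  assumes "\<And>i. prob_space (M i)" "finite I" "i \<in> I" and f [measurable]: "integrable (M i) f"
  shows "integrable (PiM I M) (\<lambda>x. f (x i))" "(\<integral>x. f (x i) \<partial>PiM I M) = integral\<^sup>L (M i) f"
proof -
  have distr: "distr (PiM I M) (M i) (\<lambda>x. x i) = M i"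
    using assms by (intro distr_PiM_component)
  have [measurable]: "(\<lambda>x. x i) \<in> measurable (PiM I M) (M i)"
    using assms by (intro measurable_component_singleton)
  show "integrable (PiM I M) (\<lambda>x. f (x i))"
    using integrable_distr[of "\<lambda>x. x i" "PiM I M" "M i" f] f unfolding distr by simp
  show "(\<integral>x. f (x i) \<partial>PiM I M) = integral\<^sup>L (M i) f"
    using integral_distr[of "\<lambda>x. x i" "PiM I M" "M i" f] unfolding distr by simp
qed

text \<open>By Fubini the coordinate \<open>j\<close> is integrated first with the others frozen,
  where the one-dimensional identity applies. Derivative, continuity and bounds are required at all
  functions \<open>x\<close>, so they can be used at points of the product over
  \<open>I - {j}\<close> directly.\<close>

lemma gaussian_integration_by_parts:
  fixes f f' :: "('i \<Rightarrow> real) \<Rightarrow> real"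
  assumes I: "finite I" "j \<in> I"
    and [measurable]: "f \<in> borel_measurable (PiM I (\<lambda>_. std_gaussian))"
      "f' \<in> borel_measurable (PiM I (\<lambda>_. std_gaussian))"
    and deriv: "\<And>x y. ((\<lambda>y. f (x(j := y))) has_real_derivative f' (x(j := y))) (at y)"
    and cont: "\<And>x y. isCont (\<lambda>y. f' (x(j := y))) y"
    and bound: "\<And>x. \<bar>f x\<bar> \<le> B" "\<And>x. \<bar>f' x\<bar> \<le> B'"
  shows "integrable (PiM I (\<lambda>_. std_gaussian)) (\<lambda>x. x j * f x)"
    "(\<integral>x. x j * f x \<partial>PiM I (\<lambda>_. std_gaussian)) = (\<integral>x. f' x \<partial>PiM I (\<lambda>_. std_gaussian))"
proof -
  let ?G = "\<lambda>_ :: 'i. std_gaussian"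
  interpret G: prob_space std_gaussian by (rule prob_space_std_gaussian)
  interpret product_prob_space ?G by standard
  have [measurable]: "(\<lambda>x. x j) \<in> borel_measurable (PiM I ?G)"
    using measurable_component_singleton[OF \<open>j \<in> I\<close>, of ?G]
    unfolding measurable_cong_sets[OF refl sets_std_gaussian] .
  interpret P: prob_space "PiM I ?G" by (rule prob_space_PiM) (rule prob_space_std_gaussian)
  show int: "integrable (PiM I ?G) (\<lambda>x. x j * f x)"
  proof (rule Bochner_Integration.integrable_bound)
    show "integrable (PiM I ?G) (\<lambda>x. x j * B)"
      using I std_gaussian_moments(1)
      by (intro integrable_mult_left integral_PiM_component(1) prob_space_std_gaussian)
        (auto simp: has_bochner_integral_iff)
    show "AE x in PiM I ?G. norm (x j * f x) \<le> norm (x j * B)"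
      using order.trans[OF bound(1) abs_ge_self] by (simp add: abs_mult mult_left_mono)
  qed simp
  have int': "integrable (PiM I ?G) f'"
    using bound(2) by (intro P.integrable_const_bound[where B=B']) auto
  have ins: "insert j (I - {j}) = I"
    using I by auto
  have "(\<integral>x. x j * f x \<partial>PiM I ?G) = (\<integral>x. (\<integral>y. (x(j:=y)) j * f (x(j := y)) \<partial>std_gaussian) \<partial>PiM (I - {j}) ?G)"
    using product_integral_insert[of "I - {j}" j "\<lambda>x. x j * f x"] I int unfolding ins by simp
  also have "\<dots> = (\<integral>x. (\<integral>y. f' (x(j := y)) \<partial>std_gaussian) \<partial>PiM (I - {j}) ?G)"
    by (simp only: fun_upd_same std_gaussian_integration_by_parts[OF deriv cont bound])
  also have "\<dots> = (\<integral>x. f' x \<partial>PiM I ?G)"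
    using product_integral_insert[of "I - {j}" j f'] I int' unfolding ins by simp
  finally show "(\<integral>x. x j * f x \<partial>PiM I ?G) = (\<integral>x. f' x \<partial>PiM I ?G)" .
qed

text \<open>After expanding the square, the off-diagonal terms vanish by independence and mean zero,
  and each diagonal term contributes the variance 1.\<close>

lemma integral_PiM_sum_square:
  fixes D :: "real measure"
  assumes D: "prob_space D" and I: "finite I"
    and mean: "has_bochner_integral D (\<lambda>x. x) 0" and var: "has_bochner_integral D (\<lambda>x. x\<^sup>2) 1"
  shows "has_bochner_integral (PiM I (\<lambda>_. D)) (\<lambda>x. (\<Sum>i\<in>I. x i)\<^sup>2) (card I)"
proof -
  interpret D: prob_space D by fact
  interpret product_prob_space "\<lambda>_. D" by standard
  have "has_bochner_integral (PiM I (\<lambda>_. D)) (\<lambda>x. x i * x j) (if i = j then 1 else 0)"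
    if ij: "i \<in> I" "j \<in> I" for i j
  proof (cases "i = j")
    case True
    then show ?thesis
      using integral_PiM_component[of "\<lambda>_. D" I i "\<lambda>x. x\<^sup>2"] D I ij var
      by (simp add: has_bochner_integral_iff power2_eq_square)
  next
    case False
    \<comment> \<open>Factors equal to 1 off \<open>{i, j}\<close> write \<open>x i * x j\<close> as
      a product over all of \<open>I\<close>, the form to which the integration rule for product
      functions applies.\<close>
    let ?g = "\<lambda>k x. if k = i \<or> k = j then x else 1 :: real"
    have g: "integrable D (?g k)" for k
      using mean by (cases "k = i \<or> k = j") (auto simp: has_bochner_integral_iff)
    have "(\<Prod>k\<in>I. ?g k (x k)) = (\<Prod>k\<in>{i, j}. x k)" for x
      using I ij by (intro prod.mono_neutral_cong_right) auto
    then have prod: "(\<Prod>k\<in>I. ?g k (x k)) = x i * x j" for x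
      using False by simp
    have "(\<Prod>k\<in>I. integral\<^sup>L D (?g k)) = 0"
      using mean ij I by (auto simp: has_bochner_integral_iff intro!: bexI[of _ i])
    then show ?thesis
      using product_integrable_prod[of I ?g] product_integral_prod[of I ?g] I g False
      by (simp add: prod has_bochner_integral_iff)
  qed
  then have "has_bochner_integral (PiM I (\<lambda>_. D)) (\<lambda>x. \<Sum>i\<in>I. \<Sum>j\<in>I. x i * x j)
      (\<Sum>i\<in>I. \<Sum>j\<in>I. if i = j then 1 else 0)"
    by (intro has_bochner_integral_sum)
  then show ?thesis
    using I by (simp add: power2_eq_square sum_product)
qed

section \<open>The overlap variance in a strong field\<close>

lemma gibbs_mean_sum:
  "gibbs_mean d \<beta> n h J (\<lambda>\<sigma>. \<Sum>k\<in>K. f k \<sigma>) = (\<Sum>k\<in>K. gibbs_mean d \<beta> n h J (f k))"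
  unfolding gibbs_mean_def sum_distrib_left by (rule sum.swap)

lemma gibbs_mean_abs_le:
  assumes "\<And>\<sigma>. \<sigma> \<in> configs d n \<Longrightarrow> \<bar>f \<sigma>\<bar> \<le> K"
  shows "\<bar>gibbs_mean d \<beta> n h J f\<bar> \<le> K"
proof -
  have "\<bar>gibbs_mean d \<beta> n h J f\<bar> \<le> (\<Sum>\<sigma>\<in>configs d n. \<bar>gibbs d \<beta> n h J \<sigma> * f \<sigma>\<bar>)"
    unfolding gibbs_mean_def by (rule sum_abs)
  also have "\<dots> \<le> (\<Sum>\<sigma>\<in>configs d n. gibbs d \<beta> n h J \<sigma> * K)"
    using assms gibbs_pos[of d \<beta> n h J]
    by (intro sum_mono) (auto simp: abs_mult less_imp_le intro!: mult_left_mono)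
  also have "\<dots> = K"
    by (simp add: sum_distrib_right[symmetric] sum_gibbs)
  finally show ?thesis .
qed

text \<open>Covers also sites outside the box, where every point of the product space takes the
  constant value \<open>undefined\<close>. This makes the identity into the full function space
  \<open>int list \<Rightarrow> real\<close> measurable coordinate by coordinate.\<close>

lemma disorder_component_measurable:
  assumes D: "sets D = sets borel"
  shows "(\<lambda>J. J i) \<in> borel_measurable (disorder d n D)"
proof (cases "i \<in> box d n")
  case True
  show ?thesis
    using measurable_component_singleton[OF True, of "\<lambda>_. D"]
    unfolding measurable_cong_sets[OF refl D] disorder_def .
next
  case False
  then have "J i = undefined" if "J \<in> space (disorder d n D)" for J
    using that by (auto simp: disorder_def space_PiM PiE_def extensional_def)
  then show ?thesis
    by (subst measurable_cong[of _ _ "\<lambda>_. undefined"]) auto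
qed

lemma hamiltonian_measurable:
  assumes "sets D = sets borel"
  shows "(\<lambda>J. hamiltonian d n h J \<sigma>) \<in> borel_measurable (disorder d n D)"
  unfolding hamiltonian_def
  by (intro borel_measurable_diff borel_measurable_const borel_measurable_times borel_measurable_sum
      disorder_component_measurable assms)

lemma gibbs_measurable:
  assumes "sets D = sets borel"
  shows "(\<lambda>J. gibbs d \<beta> n h J \<sigma>) \<in> borel_measurable (disorder d n D)"
  unfolding gibbs_def partition_fn_def using hamiltonian_measurable[OF assms] by measurable

lemma gibbs_mean_measurable:
  assumes "sets D = sets borel"
  shows "(\<lambda>J. gibbs_mean d \<beta> n h J f) \<in> borel_measurable (disorder d n D)"
  unfolding gibbs_mean_def using gibbs_measurable[OF assms] by measurable

text \<open>The field at \<open>j\<close> enters the exponent linearly with coefficient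
  \<open>\<beta> h / sqrt N\<close> times \<open>\<sigma> j\<close>, so the quotient rule produces a
  Gibbs covariance with \<open>\<sigma> j\<close>. A general \<open>f\<close> is allowed because the
  formula serves twice: for the derivative of the mean total spin and for the continuity of that
  derivative.\<close>

lemma gibbs_mean_has_derivative:
  assumes j: "j \<in> box d n"
  shows "((\<lambda>y. gibbs_mean d \<beta> n h (J(j := y)) f) has_real_derivative
     \<beta> * h / sqrt (card (box d n)) * (gibbs_mean d \<beta> n h (J(j := y)) (\<lambda>\<sigma>. f \<sigma> * \<sigma> j)
       - gibbs_mean d \<beta> n h (J(j := y)) f * gibbs_mean d \<beta> n h (J(j := y)) (\<lambda>\<sigma>. \<sigma> j))) (at y)"
proof -
  let ?c = "\<beta> * h / sqrt (card (box d n))"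
  define W where "W \<sigma> y = exp (- \<beta> * hamiltonian d n h (J(j := y)) \<sigma>)" for \<sigma> y
  define Z where "Z y = (\<Sum>\<sigma>\<in>configs d n. W \<sigma> y)" for y
  have "(\<Sum>i\<in>box d n. (J(j := y)) i * \<sigma> i) = y * \<sigma> j + (\<Sum>i\<in>box d n - {j}. J i * \<sigma> i)" for \<sigma> y
    using j by (subst sum.remove[of _ j]) (auto intro!: sum.cong)
  then have H: "- \<beta> * hamiltonian d n h (J(j := y)) \<sigma> = \<beta> * (\<Sum>e\<in>edges d n. \<Prod>v\<in>e. \<sigma> v)
      + ?c * (y * \<sigma> j + (\<Sum>i\<in>box d n - {j}. J i * \<sigma> i))" for \<sigma> y
    by (simp add: hamiltonian_def algebra_simps del: fun_upd_apply)
  have "((\<lambda>y. W \<sigma> y) has_real_derivative ?c * (W \<sigma> y * \<sigma> j)) (at y)" for \<sigma> y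
    unfolding W_def H by (rule derivative_eq_intros refl)+ simp
  note W' = this
  have Zpos: "Z y > 0" for y
    using partition_fn_pos by (simp add: Z_def W_def partition_fn_def)
  have mean: "gibbs_mean d \<beta> n h (J(j := y)) f = (\<Sum>\<sigma>\<in>configs d n. W \<sigma> y * f \<sigma>) / Z y" for f y
    by (simp add: gibbs_mean_def gibbs_def partition_fn_def W_def Z_def sum_divide_distrib)
  have "((\<lambda>y. (\<Sum>\<sigma>\<in>configs d n. W \<sigma> y * f \<sigma>) / Z y) has_real_derivative
     ((\<Sum>\<sigma>\<in>configs d n. ?c * (W \<sigma> y * \<sigma> j) * f \<sigma>) * Z y
       - (\<Sum>\<sigma>\<in>configs d n. W \<sigma> y * f \<sigma>) * (\<Sum>\<sigma>\<in>configs d n. ?c * (W \<sigma> y * \<sigma> j))) / (Z y * Z y)) (at y)"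
    using Zpos[of y] unfolding Z_def
    by (intro DERIV_divide DERIV_sum DERIV_cmult_right W') auto
  also have "(\<Sum>\<sigma>\<in>configs d n. ?c * (W \<sigma> y * \<sigma> j) * f \<sigma>) = ?c * (\<Sum>\<sigma>\<in>configs d n. W \<sigma> y * (f \<sigma> * \<sigma> j))"
    by (simp add: sum_distrib_left mult_ac)
  also have "(\<Sum>\<sigma>\<in>configs d n. ?c * (W \<sigma> y * \<sigma> j)) = ?c * (\<Sum>\<sigma>\<in>configs d n. W \<sigma> y * \<sigma> j)"
    by (simp add: sum_distrib_left mult_ac)
  also have "(c * F * Z y - G * (c * H)) / (Z y * Z y) = c * (F / Z y - G / Z y * (H / Z y))" for c F G H
    using Zpos[of y] by (simp add: field_simps)
  finally show ?thesis
    unfolding mean .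
qed

section \<open>Two-replica averages and the variance of the overlap\<close>

lemma gibbs2_sum_prod:
  "gibbs2 d \<beta> n h J (\<lambda>\<sigma>1 \<sigma>2. \<Sum>k\<in>K. f k \<sigma>1 * g k \<sigma>2)
    = (\<Sum>k\<in>K. gibbs_mean d \<beta> n h J (f k) * gibbs_mean d \<beta> n h J (g k))"
proof -
  have "gibbs2 d \<beta> n h J (\<lambda>\<sigma>1 \<sigma>2. \<Sum>k\<in>K. f k \<sigma>1 * g k \<sigma>2)
    = (\<Sum>\<sigma>1\<in>configs d n. \<Sum>k\<in>K. \<Sum>\<sigma>2\<in>configs d n. gibbs d \<beta> n h J \<sigma>1 * f k \<sigma>1 * (gibbs d \<beta> n h J \<sigma>2 * g k \<sigma>2))"
    unfolding gibbs2_def sum_distrib_left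
    by (subst (2) sum.swap) (simp add: mult_ac)
  also have "\<dots> = (\<Sum>k\<in>K. gibbs_mean d \<beta> n h J (f k) * gibbs_mean d \<beta> n h J (g k))"
    unfolding gibbs_mean_def sum_product by (rule sum.swap)
  finally show ?thesis .
qed

lemma gibbs2_add: "gibbs2 d \<beta> n h J (\<lambda>a b. f a b + g a b) = gibbs2 d \<beta> n h J f + gibbs2 d \<beta> n h J g"
  by (simp add: gibbs2_def distrib_left sum.distrib)

lemma gibbs2_cmult: "gibbs2 d \<beta> n h J (\<lambda>a b. c * f a b) = c * gibbs2 d \<beta> n h J f"
  by (simp add: gibbs2_def sum_distrib_left mult_ac)

lemma gibbs2_const: "gibbs2 d \<beta> n h J (\<lambda>a b. c) = c"
  by (simp add: gibbs2_def sum_distrib_left[symmetric] sum_distrib_right[symmetric] sum_gibbs)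

lemma gibbs2_variance:
  "gibbs2 d \<beta> n h J (\<lambda>a b. (f a b - gibbs2 d \<beta> n h J f)\<^sup>2)
    = gibbs2 d \<beta> n h J (\<lambda>a b. (f a b)\<^sup>2) - (gibbs2 d \<beta> n h J f)\<^sup>2"
proof -
  let ?m = "gibbs2 d \<beta> n h J f"
  have "(\<lambda>a b. (f a b - ?m)\<^sup>2) = (\<lambda>a b. (f a b)\<^sup>2 + ((- 2 * ?m) * f a b + ?m\<^sup>2))"
    by (simp add: power2_diff fun_eq_iff)
  then show ?thesis
    by (simp only: gibbs2_add gibbs2_cmult gibbs2_const) (simp add: power2_eq_square)
qed

definition spin_cov :: "nat \<Rightarrow> real \<Rightarrow> nat \<Rightarrow> real \<Rightarrow> (int list \<Rightarrow> real) \<Rightarrow> int list \<Rightarrow> int list \<Rightarrow> real" where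
  "spin_cov d \<beta> n h J i j = gibbs_mean d \<beta> n h J (\<lambda>\<sigma>. \<sigma> i * \<sigma> j)
     - gibbs_mean d \<beta> n h J (\<lambda>\<sigma>. \<sigma> i) * gibbs_mean d \<beta> n h J (\<lambda>\<sigma>. \<sigma> j)"

abbreviation (input) overlap_variance where
  "overlap_variance d \<beta> n h J \<equiv> gibbs2 d \<beta> n h J
     (\<lambda>\<sigma>1 \<sigma>2. (overlap d n \<sigma>1 \<sigma>2 - gibbs2 d \<beta> n h J (overlap d n))\<^sup>2)"

text \<open>The overlap and its square are sums of terms in which the same spin monomial is
  evaluated on both replicas. By independence of the replicas each term averages to the square of a
  one-replica correlation.\<close>

lemma overlap_variance_eq:
  "overlap_variance d \<beta> n h J = (\<Sum>i\<in>box d n. \<Sum>j\<in>box d n. (gibbs_mean d \<beta> n h J (\<lambda>\<sigma>. \<sigma> i * \<sigma> j))\<^sup>2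
     - (gibbs_mean d \<beta> n h J (\<lambda>\<sigma>. \<sigma> i) * gibbs_mean d \<beta> n h J (\<lambda>\<sigma>. \<sigma> j))\<^sup>2) / (real (card (box d n)))\<^sup>2"
proof -
  let ?N = "real (card (box d n))" and ?V = "box d n" and ?m = "gibbs_mean d \<beta> n h J"
  have "overlap d n = (\<lambda>\<sigma>1 \<sigma>2. (1 / ?N) * (\<Sum>i\<in>?V. \<sigma>1 i * \<sigma>2 i))"
    by (simp add: overlap_def fun_eq_iff)
  then have 1: "gibbs2 d \<beta> n h J (overlap d n) = (\<Sum>i\<in>?V. ?m (\<lambda>\<sigma>. \<sigma> i) * ?m (\<lambda>\<sigma>. \<sigma> i)) / ?N"
    by (simp only: gibbs2_cmult gibbs2_sum_prod) simp
  \<comment> \<open>Indexing the square by a single pair \<open>k\<close> of sites fits the single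
    sum in \<open>gibbs2_sum_prod\<close>.\<close>
  have "(\<lambda>\<sigma>1 \<sigma>2. (overlap d n \<sigma>1 \<sigma>2)\<^sup>2)
      = (\<lambda>\<sigma>1 \<sigma>2. (1 / ?N\<^sup>2) * (\<Sum>k\<in>?V\<times>?V. (\<sigma>1 (fst k) * \<sigma>1 (snd k)) * (\<sigma>2 (fst k) * \<sigma>2 (snd k))))"
    by (simp add: overlap_def fun_eq_iff power2_eq_square sum_product sum.cartesian_product mult_ac split_beta)
  then have 2: "gibbs2 d \<beta> n h J (\<lambda>\<sigma>1 \<sigma>2. (overlap d n \<sigma>1 \<sigma>2)\<^sup>2)
      = (\<Sum>i\<in>?V. \<Sum>j\<in>?V. (?m (\<lambda>\<sigma>. \<sigma> i * \<sigma> j))\<^sup>2) / ?N\<^sup>2"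
    by (simp only: gibbs2_cmult gibbs2_sum_prod)
      (simp add: sum.cartesian_product split_beta power2_eq_square)
  show ?thesis
    unfolding gibbs2_variance unfolding 1 2
    by (simp add: power_divide sum_subtractf diff_divide_distrib power2_eq_square[of "sum _ _"] sum_product)
      (simp add: power2_eq_square mult_ac)
qed

lemma abs_spin_le_one: "\<sigma> \<in> configs d n \<Longrightarrow> i \<in> box d n \<Longrightarrow> \<bar>\<sigma> i\<bar> \<le> 1"
  using configs_spin by fastforce

text \<open>Each term factors as \<open>a^2 - b^2 = (a - b) (a + b)\<close>, where
  \<open>a - b\<close> is a spin covariance and \<open>a + b\<close> is at most 2. Nonnegativity of
  the covariance, from FKG, permits replacing the second factor by 2.\<close>

lemma overlap_variance_le:
  assumes "0 \<le> \<beta>"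
  shows "overlap_variance d \<beta> n h J
    \<le> 2 / (real (card (box d n)))\<^sup>2 * (\<Sum>i\<in>box d n. \<Sum>j\<in>box d n. spin_cov d \<beta> n h J i j)"
proof -
  let ?m = "gibbs_mean d \<beta> n h J"
  have "(?m (\<lambda>\<sigma>. \<sigma> i * \<sigma> j))\<^sup>2 - (?m (\<lambda>\<sigma>. \<sigma> i) * ?m (\<lambda>\<sigma>. \<sigma> j))\<^sup>2 \<le> 2 * spin_cov d \<beta> n h J i j"
    if ij: "i \<in> box d n" "j \<in> box d n" for i j
  proof -
    have m: "\<bar>?m (\<lambda>\<sigma>. \<sigma> i * \<sigma> j)\<bar> \<le> 1" "\<bar>?m (\<lambda>\<sigma>. \<sigma> i)\<bar> \<le> 1" "\<bar>?m (\<lambda>\<sigma>. \<sigma> j)\<bar> \<le> 1"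
      using ij abs_spin_le_one by (auto intro!: gibbs_mean_abs_le simp: abs_mult mult_le_one)
    have "\<bar>?m (\<lambda>\<sigma>. \<sigma> i) * ?m (\<lambda>\<sigma>. \<sigma> j)\<bar> \<le> 1"
      using m by (simp add: abs_mult mult_le_one)
    then have "?m (\<lambda>\<sigma>. \<sigma> i * \<sigma> j) + ?m (\<lambda>\<sigma>. \<sigma> i) * ?m (\<lambda>\<sigma>. \<sigma> j) \<le> 2"
      using m by linarith
    then have "spin_cov d \<beta> n h J i j * (?m (\<lambda>\<sigma>. \<sigma> i * \<sigma> j) + ?m (\<lambda>\<sigma>. \<sigma> i) * ?m (\<lambda>\<sigma>. \<sigma> j))
        \<le> spin_cov d \<beta> n h J i j * 2"
      using spin_correlation_nonneg[OF assms ij, of h J] by (intro mult_left_mono) (auto simp: spin_cov_def)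
    then show ?thesis
      by (simp add: spin_cov_def power2_eq_square algebra_simps)
  qed
  then have "(\<Sum>i\<in>box d n. \<Sum>j\<in>box d n. (?m (\<lambda>\<sigma>. \<sigma> i * \<sigma> j))\<^sup>2 - (?m (\<lambda>\<sigma>. \<sigma> i) * ?m (\<lambda>\<sigma>. \<sigma> j))\<^sup>2)
      \<le> (\<Sum>i\<in>box d n. \<Sum>j\<in>box d n. 2 * spin_cov d \<beta> n h J i j)"
    by (intro sum_mono)
  then show ?thesis
    unfolding overlap_variance_eq by (simp add: divide_right_mono sum_distrib_left[symmetric])
qed

lemma prob_space_disorder: "prob_space D \<Longrightarrow> prob_space (disorder d n D)"
  unfolding disorder_def by (rule prob_space_PiM)

text \<open>With \<open>c = \<beta> h / sqrt N\<close>, summing the integration by parts over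
  \<open>j\<close> gives \<open>E ((\<Sum> J j) M) = c E (\<Sum> C j)\<close>. The left side is at
  most \<open>N sqrt N\<close> in absolute value; dividing by \<open>\<bar>c\<bar>\<close> gives the
  bound for either sign of \<open>h\<close>.\<close>

lemma expectation_sum_spin_cov_le:
  assumes "\<beta> > 0" "h \<noteq> 0"
  shows "integrable (disorder d n std_gaussian) (\<lambda>J. \<Sum>i\<in>box d n. \<Sum>j\<in>box d n. spin_cov d \<beta> n h J i j)"
    "(\<integral>J. (\<Sum>i\<in>box d n. \<Sum>j\<in>box d n. spin_cov d \<beta> n h J i j) \<partial>disorder d n std_gaussian)
      \<le> (real (card (box d n)))\<^sup>2 / (\<beta> * \<bar>h\<bar>)"
proof -
  let ?V = "box d n" and ?P = "disorder d n std_gaussian"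
  define N where "N = real (card ?V)"
  define c where "c = \<beta> * h / sqrt N"
  define S where "S \<sigma> = (\<Sum>i\<in>?V. \<sigma> i)" for \<sigma> :: "int list \<Rightarrow> real"
  define M where "M J = gibbs_mean d \<beta> n h J S" for J
  define C where "C J j = (\<Sum>i\<in>?V. spin_cov d \<beta> n h J i j)" for J j
  interpret P: prob_space ?P
    by (rule prob_space_disorder prob_space_std_gaussian)+
  have N: "N > 0"
    using card_box_pos by (simp add: N_def)
  then have c: "c \<noteq> 0" "\<bar>1 / c\<bar> = sqrt N / (\<beta> * \<bar>h\<bar>)"
    using assms by (auto simp: c_def abs_mult)
  have S_le: "\<bar>S \<sigma>\<bar> \<le> N" if "\<sigma> \<in> configs d n" for \<sigma>
  proof -
    have "\<bar>S \<sigma>\<bar> \<le> (\<Sum>i\<in>?V. \<bar>\<sigma> i\<bar>)"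
      unfolding S_def by (rule sum_abs)
    also have "\<dots> \<le> (\<Sum>i\<in>?V. 1)"
      using that by (intro sum_mono abs_spin_le_one)
    finally show ?thesis by (simp add: N_def)
  qed
  then have M_le: "\<bar>M J\<bar> \<le> N" for J
    unfolding M_def by (intro gibbs_mean_abs_le)
  \<comment> \<open>By linearity \<open>C J j\<close> is the Gibbs covariance of the total spin with
    \<open>\<sigma> j\<close>, so \<open>c * C J j\<close> is the derivative of \<open>M\<close> in
    the field at \<open>j\<close>.\<close>
  have C_eq: "C J j = gibbs_mean d \<beta> n h J (\<lambda>\<sigma>. S \<sigma> * \<sigma> j) - M J * gibbs_mean d \<beta> n h J (\<lambda>\<sigma>. \<sigma> j)" for J j
    by (simp add: C_def spin_cov_def S_def[abs_def] M_def gibbs_mean_sum sum_distrib_right sum_subtractf)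
  have [measurable]: "M \<in> borel_measurable ?P" "(\<lambda>J. C J j) \<in> borel_measurable ?P" for j
    unfolding C_eq M_def[abs_def] using gibbs_mean_measurable[OF sets_std_gaussian] by measurable
  have ibp: "integrable ?P (\<lambda>J. J j * M J)" "integrable ?P (\<lambda>J. C J j)"
    "(\<integral>J. J j * M J \<partial>?P) = c * (\<integral>J. C J j \<partial>?P)" if j: "j \<in> ?V" for j
  proof -
    have C_le: "\<bar>C J j\<bar> \<le> N + N" for J
    proof -
      have "\<bar>gibbs_mean d \<beta> n h J (\<lambda>\<sigma>. S \<sigma> * \<sigma> j)\<bar> \<le> N"
        using S_le abs_spin_le_one[OF _ j] mult_mono[of "\<bar>S _\<bar>" N "\<bar>_ j\<bar>" 1] N
        by (intro gibbs_mean_abs_le) (auto simp: abs_mult)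
      moreover have "\<bar>M J * gibbs_mean d \<beta> n h J (\<lambda>\<sigma>. \<sigma> j)\<bar> \<le> N * 1"
        unfolding abs_mult using N M_le abs_spin_le_one[OF _ j]
        by (intro mult_mono gibbs_mean_abs_le) auto
      ultimately show ?thesis
        unfolding C_eq by linarith
    qed
    have M': "((\<lambda>y. M (J(j := y))) has_real_derivative c * C (J(j := y)) j) (at y)" for J y
      unfolding C_eq M_def c_def N_def by (rule gibbs_mean_has_derivative[OF j])
    \<comment> \<open>Each Gibbs mean occurring in \<open>C_eq\<close> is itself differentiable in
      the field at \<open>j\<close>, hence continuous.\<close>
    have C': "isCont (\<lambda>y. c * C (J(j := y)) j) y" for J y
      unfolding C_eq M_def by (intro continuous_intros DERIV_isCont[OF gibbs_mean_has_derivative[OF j]])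
    note parts = gaussian_integration_by_parts[OF finite_box j _ _ M' C' M_le, folded disorder_def,
        where B' = "\<bar>c\<bar> * (N + N)"]
    show "integrable ?P (\<lambda>J. J j * M J)"
      by (rule parts(1)) (use C_le in \<open>auto simp: abs_mult mult_left_mono\<close>)
    show "integrable ?P (\<lambda>J. C J j)"
      using C_le by (intro P.integrable_const_bound[where B="N+N"]) auto
    have "(\<integral>J. J j * M J \<partial>?P) = (\<integral>J. c * C J j \<partial>?P)"
      by (rule parts(2)) (use C_le in \<open>auto simp: abs_mult mult_left_mono\<close>)
    then show "(\<integral>J. J j * M J \<partial>?P) = c * (\<integral>J. C J j \<partial>?P)"
      by simp
  qed
  have swap: "(\<Sum>i\<in>?V. \<Sum>j\<in>?V. spin_cov d \<beta> n h J i j) = (\<Sum>j\<in>?V. C J j)" for J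
    unfolding C_def by (rule sum.swap)
  show "integrable ?P (\<lambda>J. \<Sum>i\<in>?V. \<Sum>j\<in>?V. spin_cov d \<beta> n h J i j)"
    unfolding swap using ibp by (intro Bochner_Integration.integrable_sum)
  have sq: "has_bochner_integral ?P (\<lambda>J. (\<Sum>i\<in>?V. J i)\<^sup>2) N"
    unfolding disorder_def N_def
    by (intro integral_PiM_sum_square prob_space_std_gaussian finite_box std_gaussian_moments)
  \<comment> \<open>Young's inequality with weight \<open>sqrt N\<close>: since the squared sum has
    expectation \<open>N\<close>, both halves contribute equally and the expectation of the bound is
    exactly \<open>N * sqrt N\<close>.\<close>
  let ?b = "\<lambda>J. N * (((\<Sum>i\<in>?V. J i)\<^sup>2 / sqrt N + sqrt N) / 2)"
  have b: "\<bar>(\<Sum>j\<in>?V. J j) * M J\<bar> \<le> ?b J" for J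
  proof -
    let ?x = "\<Sum>j\<in>?V. J j" and ?a = "sqrt N"
    have "0 \<le> (\<bar>?x\<bar> - ?a)\<^sup>2 / ?a"
      using N by simp
    also have "(\<bar>?x\<bar> - ?a)\<^sup>2 / ?a = ?x\<^sup>2 / ?a + ?a - 2 * \<bar>?x\<bar>"
      using N by (simp add: power2_diff field_simps)
    finally have "\<bar>?x\<bar> \<le> (?x\<^sup>2 / ?a + ?a) / 2"
      by simp
    then have "\<bar>?x\<bar> * \<bar>M J\<bar> \<le> (?x\<^sup>2 / ?a + ?a) / 2 * N"
      using M_le by (intro mult_mono) auto
    then show ?thesis by (simp add: abs_mult mult_ac)
  qed
  have "\<bar>\<integral>J. (\<Sum>j\<in>?V. J j) * M J \<partial>?P\<bar> \<le> (\<integral>J. ?b J \<partial>?P)"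
  proof (rule order.trans[OF integral_abs_bound integral_mono])
    show "integrable ?P (\<lambda>J. \<bar>(\<Sum>j\<in>?V. J j) * M J\<bar>)"
      unfolding sum_distrib_right using ibp by (intro integrable_abs Bochner_Integration.integrable_sum)
    show "integrable ?P ?b"
      using sq by (auto simp: has_bochner_integral_iff)
  qed (use b in auto)
  also have "\<dots> = N * ((N / sqrt N + sqrt N) / 2)"
    using sq by (simp add: has_bochner_integral_iff P.prob_space)
  also have "\<dots> = N * sqrt N"
    using N by (simp add: real_div_sqrt)
  also have "(\<integral>J. (\<Sum>j\<in>?V. J j) * M J \<partial>?P) = c * (\<integral>J. (\<Sum>j\<in>?V. C J j) \<partial>?P)"
    unfolding sum_distrib_right using ibp by (simp add: sum_distrib_left)
  finally have "\<bar>c\<bar> * \<bar>\<integral>J. (\<Sum>j\<in>?V. C J j) \<partial>?P\<bar> \<le> N * sqrt N"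
    by (simp add: abs_mult)
  then have "\<bar>\<integral>J. (\<Sum>j\<in>?V. C J j) \<partial>?P\<bar> \<le> N * sqrt N * \<bar>1 / c\<bar>"
    using c(1) by (simp add: field_simps)
  also have "\<dots> = N\<^sup>2 / (\<beta> * \<bar>h\<bar>)"
    unfolding c(2) using N by (simp add: power2_eq_square)
  finally show "(\<integral>J. (\<Sum>i\<in>?V. \<Sum>j\<in>?V. spin_cov d \<beta> n h J i j) \<partial>?P) \<le> (real (card ?V))\<^sup>2 / (\<beta> * \<bar>h\<bar>)"
    unfolding swap N_def by linarith
qed

lemma abs_overlap_le_one:
  assumes "\<sigma>1 \<in> configs d n" "\<sigma>2 \<in> configs d n"
  shows "\<bar>overlap d n \<sigma>1 \<sigma>2\<bar> \<le> 1"
proof -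
  have "\<bar>\<Sum>i\<in>box d n. \<sigma>1 i * \<sigma>2 i\<bar> \<le> (\<Sum>i\<in>box d n. \<bar>\<sigma>1 i * \<sigma>2 i\<bar>)"
    by (rule sum_abs)
  also have "\<dots> \<le> (\<Sum>i\<in>box d n. 1)"
    using assms abs_spin_le_one by (intro sum_mono) (auto simp: abs_mult mult_le_one)
  finally show ?thesis
    using card_box_pos[of d n] by (simp add: overlap_def)
qed

lemma gibbs2_nonneg: "(\<And>a b. 0 \<le> f a b) \<Longrightarrow> 0 \<le> gibbs2 d \<beta> n h J f"
  unfolding gibbs2_def by (intro sum_nonneg mult_nonneg_nonneg less_imp_le[OF gibbs_pos])

lemma gibbs2_le:
  assumes "\<And>a b. a \<in> configs d n \<Longrightarrow> b \<in> configs d n \<Longrightarrow> f a b \<le> g a b"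
  shows "gibbs2 d \<beta> n h J f \<le> gibbs2 d \<beta> n h J g"
  unfolding gibbs2_def using assms
  by (intro sum_mono mult_left_mono mult_nonneg_nonneg less_imp_le[OF gibbs_pos])

lemma overlap_variance_bounds: "0 \<le> overlap_variance d \<beta> n h J" "overlap_variance d \<beta> n h J \<le> 1"
proof -
  show "0 \<le> overlap_variance d \<beta> n h J"
    by (intro gibbs2_nonneg) simp
  have "overlap_variance d \<beta> n h J \<le> gibbs2 d \<beta> n h J (\<lambda>a b. (overlap d n a b)\<^sup>2)"
    by (simp add: gibbs2_variance)
  also have "\<dots> \<le> gibbs2 d \<beta> n h J (\<lambda>a b. 1)"
    using abs_overlap_le_one by (intro gibbs2_le) (auto simp: abs_square_le_1)
  finally show "overlap_variance d \<beta> n h J \<le> 1"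
    by (simp add: gibbs2_const)
qed

lemma integrable_overlap_variance:
  assumes D: "prob_space D" "sets D = sets borel"
  shows "integrable (disorder d n D) (overlap_variance d \<beta> n h)"
proof -
  interpret P: prob_space "disorder d n D"
    by (rule prob_space_disorder D)+
  have "overlap_variance d \<beta> n h \<in> borel_measurable (disorder d n D)"
    unfolding overlap_variance_eq using gibbs_mean_measurable[OF D(2)] by measurable
  then show ?thesis
    using overlap_variance_bounds by (intro P.integrable_const_bound[where B=1]) auto
qed

text \<open>The volume factors cancel, so the bound depends on neither \<open>d\<close> nor
  \<open>n\<close> once \<open>h\<close> is fixed.\<close>

theorem expectation_overlap_variance_le:
  assumes "\<beta> > 0" "h \<noteq> 0"
  shows "(\<integral>J. overlap_variance d \<beta> n h J \<partial>disorder d n std_gaussian) \<le> 2 / (\<beta> * \<bar>h\<bar>)"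
proof -
  let ?P = "disorder d n std_gaussian" and ?N = "real (card (box d n))"
  have "(\<integral>J. overlap_variance d \<beta> n h J \<partial>?P)
      \<le> (\<integral>J. 2 / ?N\<^sup>2 * (\<Sum>i\<in>box d n. \<Sum>j\<in>box d n. spin_cov d \<beta> n h J i j) \<partial>?P)"
    using assms expectation_sum_spin_cov_le(1)[OF assms, of d n]
    by (intro integral_mono integrable_overlap_variance prob_space_std_gaussian integrable_mult_right
        overlap_variance_le) auto
  also have "\<dots> \<le> 2 / ?N\<^sup>2 * (?N\<^sup>2 / (\<beta> * \<bar>h\<bar>))"
    unfolding integral_mult_right_zero
    by (intro mult_left_mono expectation_sum_spin_cov_le assms) simp
  also have "\<dots> = 2 / (\<beta> * \<bar>h\<bar>)"
    using card_box_pos[of d n] by (auto simp: card_gt_0_iff)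
  finally show ?thesis .
qed

section \<open>Weak convergence of overlap laws\<close>

text \<open>Both laws move with \<open>n\<close>, so continuity of \<open>\<rho>\<close> at a fixed law is not enough; by Helly's theorem it is
  uniform on laws carried by a fixed bounded interval.\<close>
lemma metrizes_weak_conv_uniform:
  assumes \<rho>: "metrizes_weak_conv \<rho>" and "\<epsilon> > 0" "a < b"
  obtains \<eta> where "\<eta> > 0" "\<And>\<mu> \<nu>. real_distribution \<mu> \<Longrightarrow> real_distribution \<nu> \<Longrightarrow>
    measure \<nu> {a<..b} = 1 \<Longrightarrow> (\<And>x. \<bar>cdf \<mu> x - cdf \<nu> x\<bar> \<le> \<eta>) \<Longrightarrow> \<rho> \<mu> \<nu> \<le> \<epsilon>"
proof (rule ccontr)
  note conv = \<rho>[unfolded metrizes_weak_conv_def, THEN conjunct2, THEN conjunct2, rule_format]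
  note triangle = \<rho>[unfolded metrizes_weak_conv_def, THEN conjunct2, THEN conjunct1, rule_format]
  note metric = \<rho>[unfolded metrizes_weak_conv_def, THEN conjunct1, rule_format]
  assume "\<not> thesis"
  \<comment> \<open>If no threshold works, then \<open>1 / (k + 1)\<close> fails for every
    \<open>k\<close>, which yields two sequences of laws whose distribution functions merge while
    their distance stays above \<open>\<epsilon>\<close>.\<close>
  then have "\<exists>\<mu> \<nu>. real_distribution \<mu> \<and> real_distribution \<nu> \<and> measure \<nu> {a<..b} = 1
      \<and> (\<forall>x. \<bar>cdf \<mu> x - cdf \<nu> x\<bar> \<le> inverse (real (Suc k))) \<and> \<epsilon> < \<rho> \<mu> \<nu>" for k
    using that[of "inverse (real (Suc k))"] by (force simp: not_le)
  then obtain \<mu> \<nu> where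
    dist: "\<And>k. real_distribution (\<mu> k)" "\<And>k. real_distribution (\<nu> k)" and
    supp: "\<And>k. measure (\<nu> k) {a<..b} = 1" and
    close: "\<And>k x. \<bar>cdf (\<mu> k) x - cdf (\<nu> k) x\<bar> \<le> inverse (real (Suc k))" and
    far: "\<And>k. \<epsilon> < \<rho> (\<mu> k) (\<nu> k)"
    by metis
  \<comment> \<open>The common interval carrying all \<open>\<nu> k\<close> gives tightness, and
    hence a subsequence with a weak limit \<open>M\<close>.\<close>
  have "tight \<nu>"
    using dist supp \<open>a < b\<close> unfolding tight_def
    by (intro conjI allI impI exI[of _ a] exI[of _ b]) auto
  from tight_imp_convergent_subsubsequence[OF this strict_mono_id] obtain r M where
    r: "strict_mono (r :: nat \<Rightarrow> nat)" and M: "real_distribution M" and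
    \<nu>_conv: "weak_conv_m (\<nu> \<circ> r) M"
    by auto
  \<comment> \<open>The uniform closeness of the distribution functions transfers the limit from
    \<open>\<nu>\<close> to \<open>\<mu>\<close>. Both subsequences then approach \<open>M\<close>
    in \<open>\<rho>\<close>, and the triangle inequality contradicts \<open>far\<close>.\<close>
  have "weak_conv_m (\<mu> \<circ> r) M"
    unfolding weak_conv_m_def weak_conv_def
  proof safe
    fix x assume "isCont (cdf M) x"
    then have "(\<lambda>k. cdf ((\<nu> \<circ> r) k) x) \<longlonglongrightarrow> cdf M x"
      using \<nu>_conv by (auto simp: weak_conv_m_def weak_conv_def)
    moreover have "(\<lambda>k. cdf ((\<mu> \<circ> r) k) x - cdf ((\<nu> \<circ> r) k) x) \<longlonglongrightarrow> 0"
    proof (rule Lim_null_comparison)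
      show "(\<lambda>k. inverse (real (Suc (r k)))) \<longlonglongrightarrow> 0"
        using LIMSEQ_subseq_LIMSEQ[OF LIMSEQ_inverse_real_of_nat r] by (simp add: o_def)
    qed (use close in \<open>auto intro!: always_eventually\<close>)
    ultimately show "(\<lambda>k. cdf ((\<mu> \<circ> r) k) x) \<longlonglongrightarrow> cdf M x"
      using tendsto_add by fastforce
  qed
  then have "(\<lambda>k. \<rho> ((\<mu> \<circ> r) k) M + \<rho> ((\<nu> \<circ> r) k) M) \<longlonglongrightarrow> 0 + 0"
    using conv[of "\<mu> \<circ> r" M] conv[of "\<nu> \<circ> r" M] \<nu>_conv dist M by (intro tendsto_add) auto
  then have "\<forall>\<^sub>F k in sequentially. \<rho> ((\<mu> \<circ> r) k) M + \<rho> ((\<nu> \<circ> r) k) M < \<epsilon>"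
    using \<open>\<epsilon> > 0\<close> by (intro order_tendstoD) auto
  then obtain k where "\<rho> (\<mu> (r k)) M + \<rho> (\<nu> (r k)) M < \<epsilon>"
    by (auto simp: eventually_sequentially)
  moreover have "\<rho> (\<mu> (r k)) (\<nu> (r k)) \<le> \<rho> (\<mu> (r k)) M + \<rho> M (\<nu> (r k))"
    by (intro triangle dist M)
  moreover have "\<rho> M (\<nu> (r k)) = \<rho> (\<nu> (r k)) M"
    using metric[OF M dist(2)] by blast
  ultimately show False
    using far[of "r k"] by linarith
qed

text \<open>Passes from the quenched law as an image measure to a finite double sum; total mass,
  support and distribution function are all read off from it.\<close>

lemma emeasure_overlap_law:
  assumes A: "A \<in> sets borel"
  shows "emeasure (overlap_law d \<beta> n h J) A = ennreal (gibbs2 d \<beta> n h J (\<lambda>\<sigma>1 \<sigma>2. indicator A (overlap d n \<sigma>1 \<sigma>2)))"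
proof -
  let ?C = "configs d n" and ?G = "gibbs_pair_measure d \<beta> n h J"
  let ?R = "\<lambda>(\<sigma>1, \<sigma>2). overlap d n \<sigma>1 \<sigma>2" and ?g = "gibbs d \<beta> n h J"
  have sets: "sets ?G = sets (count_space (?C \<times> ?C))" and space: "space ?G = ?C \<times> ?C"
    by (simp_all add: gibbs_pair_measure_def)
  have "?R \<in> borel_measurable ?G"
    unfolding measurable_cong_sets[OF sets refl] by (simp add: space_borel)
  then have "emeasure (overlap_law d \<beta> n h J) A = emeasure ?G (?R -` A \<inter> (?C \<times> ?C))"
    using A by (simp add: overlap_law_def emeasure_distr space)
  also have "\<dots> = (\<Sum>x\<in>?C \<times> ?C. ennreal (?g (fst x) * ?g (snd x)) * indicator (?R -` A \<inter> (?C \<times> ?C)) x)"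
    unfolding gibbs_pair_measure_def
    by (subst emeasure_density) (auto simp: nn_integral_count_space_finite split_beta)
  also have "\<dots> = (\<Sum>x\<in>?C \<times> ?C. ennreal (?g (fst x) * ?g (snd x) * indicator A (?R x)))"
    by (intro sum.cong refl) (auto simp: indicator_def)
  also have "\<dots> = ennreal (\<Sum>x\<in>?C \<times> ?C. ?g (fst x) * ?g (snd x) * indicator A (?R x))"
    by (intro sum_ennreal mult_nonneg_nonneg less_imp_le[OF gibbs_pos]) auto
  finally show ?thesis
    by (simp only: gibbs2_def sum.cartesian_product case_prod_unfold)
qed

lemma real_distribution_overlap_law: "real_distribution (overlap_law d \<beta> n h J)"
proof -
  have "emeasure (overlap_law d \<beta> n h J) UNIV = 1"
    by (simp add: emeasure_overlap_law gibbs2_const)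
  then have "prob_space (overlap_law d \<beta> n h J)"
    by (intro prob_spaceI) (simp add: overlap_law_def)
  then show ?thesis
    by (simp add: real_distribution_def real_distribution_axioms_def overlap_law_def)
qed

lemma measure_overlap_law:
  assumes "A \<in> sets borel"
  shows "measure (overlap_law d \<beta> n h J) A = gibbs2 d \<beta> n h J (\<lambda>\<sigma>1 \<sigma>2. indicator A (overlap d n \<sigma>1 \<sigma>2))"
  using assms by (simp add: measure_def emeasure_overlap_law gibbs2_nonneg)

text \<open>Tightness is phrased with half-open intervals. The left end -2 leaves room for the
  overlap value -1, which an interval open at -1 would lose.\<close>

lemma measure_overlap_law_support: "measure (overlap_law d \<beta> n h J) {-2<..1} = 1"
proof -
  have "gibbs2 d \<beta> n h J (\<lambda>\<sigma>1 \<sigma>2. indicator {-2<..1} (overlap d n \<sigma>1 \<sigma>2)) = gibbs2 d \<beta> n h J (\<lambda>_ _. 1)"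
    unfolding gibbs2_def using abs_overlap_le_one[of _ d n]
    by (intro sum.cong arg_cong2[where f="(*)"] refl) (force simp: indicator_def abs_le_iff)
  then show ?thesis
    by (simp add: measure_overlap_law gibbs2_const)
qed

lemma cdf_overlap_law:
  "cdf (overlap_law d \<beta> n h J) x = gibbs2 d \<beta> n h J (\<lambda>\<sigma>1 \<sigma>2. indicator {..x} (overlap d n \<sigma>1 \<sigma>2))"
  by (simp add: cdf_def measure_overlap_law)

lemma gibbs2_tendsto:
  assumes J: "\<And>i. (\<lambda>k. J k i) \<longlonglongrightarrow> J' i"
  shows "(\<lambda>k. gibbs2 d \<beta> n h (J k) f) \<longlonglongrightarrow> gibbs2 d \<beta> n h J' f"
  using partition_fn_pos[of d \<beta> n h J']
  unfolding gibbs2_def gibbs_def partition_fn_def hamiltonian_def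
  by (intro tendsto_intros J) auto

text \<open>Since \<open>\<rho>\<close> is an arbitrary metric, measurability is derived from
  continuity: convergence of the fields makes the overlap laws converge weakly, and the distance to
  the fixed law \<open>\<nu>\<close> is 1-Lipschitz in \<open>\<rho>\<close>.\<close>

lemma overlap_law_dist_measurable:
  assumes \<rho>: "metrizes_weak_conv \<rho>" and D: "sets D = sets borel" and \<nu>: "real_distribution \<nu>"
  shows "(\<lambda>J. \<rho> (overlap_law d \<beta> n h J) \<nu>) \<in> borel_measurable (disorder d n D)"
proof -
  note conv = \<rho>[unfolded metrizes_weak_conv_def, THEN conjunct2, THEN conjunct2, rule_format]
  note triangle = \<rho>[unfolded metrizes_weak_conv_def, THEN conjunct2, THEN conjunct1, rule_format]
  note metric = \<rho>[unfolded metrizes_weak_conv_def, THEN conjunct1, rule_format]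
  let ?L = "overlap_law d \<beta> n h" and ?F = "\<lambda>J. \<rho> (overlap_law d \<beta> n h J) \<nu>"
  note L = real_distribution_overlap_law[of d \<beta> n h]
  \<comment> \<open>Continuity for the product topology on \<open>int list \<Rightarrow> real\<close>, whose Borel sets are the product sets
    because there are only countably many coordinates.\<close>
  have "?F \<in> borel_measurable borel"
  proof (rule borel_measurable_continuous_onI, unfold continuous_on_sequentially, safe)
    fix J :: "nat \<Rightarrow> int list \<Rightarrow> real" and J'
    assume J: "J \<longlonglongrightarrow> J'"
    have coord: "(\<lambda>k. J k i) \<longlonglongrightarrow> J' i" for i
      using continuous_on_tendsto_compose[OF continuous_on_product_coordinates[of i] J] by simp
    \<comment> \<open>The finitely many overlap values stay fixed and only their weights move, so
      the distribution functions converge at every point, not just at continuity points.\<close>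
    have "weak_conv_m (\<lambda>k. ?L (J k)) (?L J')"
      unfolding weak_conv_m_def weak_conv_def cdf_overlap_law
      by (intro allI impI gibbs2_tendsto coord)
    then have lim: "(\<lambda>k. \<rho> (?L (J k)) (?L J')) \<longlonglongrightarrow> 0"
      using conv[of "\<lambda>k. ?L (J k)" "?L J'"] L by blast
    have "\<bar>?F (J k) - ?F J'\<bar> \<le> \<rho> (?L (J k)) (?L J')" for k
      using triangle[OF L[of "J k"] L[of J'] \<nu>] triangle[OF L[of J'] L[of "J k"] \<nu>]
        metric[OF L[of J'] L[of "J k"]] by linarith
    then have "(\<lambda>k. ?F (J k) - ?F J') \<longlonglongrightarrow> 0"
      using lim by (intro Lim_null_comparison[OF _ lim]) auto
    then show "(?F \<circ> J) \<longlonglongrightarrow> ?F J'"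
      by (simp add: LIM_zero_iff o_def)
  qed
  moreover have "(\<lambda>J. J) \<in> borel_measurable (disorder d n D)"
    by (intro measurable_coordinatewise_then_product disorder_component_measurable D)
  ultimately show ?thesis
    by (rule measurable_compose[rotated])
qed

section \<open>The Gibbs measure in a weak field\<close>

lemma exp_le_quadratic: "exp y \<le> 1 + y + y\<^sup>2 / 2 * exp \<bar>y\<bar>" for y :: real
proof -
  obtain t where t: "\<bar>t\<bar> \<le> \<bar>y\<bar>" "exp y = 1 + y + exp t / 2 * y\<^sup>2"
    using Maclaurin_exp_le[of y 2] by (auto simp: numeral_2_eq_2)
  then have "exp t / 2 * y\<^sup>2 \<le> exp \<bar>y\<bar> / 2 * y\<^sup>2"
    by (intro mult_right_mono divide_right_mono) auto
  then show ?thesis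
    using t by (simp add: mult_ac)
qed

text \<open>A second-order expansion of the exponential: the linear term integrates to zero, and the
  remainder is \<open>t^2\<close> times an integrable envelope that does not depend on
  \<open>t\<close>.\<close>

lemma subgaussian_mgf_near_zero:
  fixes D :: "real measure"
  assumes D: "real_distribution D"
    and mean: "integrable D (\<lambda>x. x)" "(\<integral>x. x \<partial>D) = 0"
    and mgf: "\<delta> > 0" "\<And>t. \<bar>t\<bar> < \<delta> \<Longrightarrow> integrable D (\<lambda>x. exp (t * x))"
  obtains a C where "a > 0" "\<And>t. \<bar>t\<bar> \<le> a \<Longrightarrow> integrable D (\<lambda>x. exp (t * x))"
    "\<And>t. \<bar>t\<bar> \<le> a \<Longrightarrow> (\<integral>x. exp (t * x) \<partial>D) \<le> exp (C * t\<^sup>2)"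
proof -
  interpret real_distribution D by fact
  \<comment> \<open>A quarter of \<open>\<delta>\<close> keeps exponents up to \<open>2 * a\<close>
    admissible: one \<open>a\<close> absorbs the factor \<open>x^2\<close> of the remainder, the
    other absorbs \<open>exp \<bar>t * x\<bar>\<close>. The constant \<open>C\<close> is the
    integral of the resulting envelope divided by \<open>a^2\<close>.\<close>
  define a where "a = \<delta> / 4"
  define C where "C = (\<integral>x. exp (2 * a * x) + exp (- 2 * a * x) \<partial>D) / a\<^sup>2"
  have a: "a > 0" and int: "\<bar>t\<bar> \<le> 2 * a \<Longrightarrow> integrable D (\<lambda>x. exp (t * x))" for t
    using mgf by (auto simp: a_def)
  have int2: "integrable D (\<lambda>x. exp (2 * a * x) + exp (- 2 * a * x))"
    using int[of "2 * a"] int[of "- 2 * a"] a by (intro Bochner_Integration.integrable_add) auto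
  have bound: "exp (t * x) \<le> 1 + t * x + t\<^sup>2 / a\<^sup>2 * (exp (2 * a * x) + exp (- 2 * a * x))"
    if t: "\<bar>t\<bar> \<le> a" for t x
  proof -
    have "(a * \<bar>x\<bar>)\<^sup>2 / 2 \<le> exp (a * \<bar>x\<bar>)"
      using exp_lower_Taylor_quadratic[of "a * \<bar>x\<bar>"] a by (smt (verit) mult_nonneg_nonneg abs_ge_zero)
    then have 1: "x\<^sup>2 / 2 \<le> exp (a * \<bar>x\<bar>) / a\<^sup>2"
      using a by (simp add: power_mult_distrib field_simps)
    have 2: "exp \<bar>t * x\<bar> \<le> exp (a * \<bar>x\<bar>)"
      using t by (simp add: abs_mult mult_right_mono)
    have "(t * x)\<^sup>2 / 2 * exp \<bar>t * x\<bar> = t\<^sup>2 * (x\<^sup>2 / 2 * exp \<bar>t * x\<bar>)"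
      by (simp add: power_mult_distrib)
    also have "\<dots> \<le> t\<^sup>2 * (exp (a * \<bar>x\<bar>) / a\<^sup>2 * exp (a * \<bar>x\<bar>))"
      using 1 2 by (intro mult_left_mono mult_mono) auto
    also have "\<dots> = t\<^sup>2 / a\<^sup>2 * exp (2 * a * \<bar>x\<bar>)"
      by (simp add: exp_add[symmetric])
    also have "\<dots> \<le> t\<^sup>2 / a\<^sup>2 * (exp (2 * a * x) + exp (- 2 * a * x))"
      by (intro mult_left_mono) (cases "x \<ge> 0"; simp)+
    finally show ?thesis
      using exp_le_quadratic[of "t * x"] by linarith
  qed
  have "(\<integral>x. exp (t * x) \<partial>D) \<le> exp (C * t\<^sup>2)" if t: "\<bar>t\<bar> \<le> a" for t
  proof -
    let ?E = "\<lambda>x. exp (2 * a * x) + exp (- 2 * a * x)"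
    have E: "(\<integral>x. ?E x \<partial>D) = C * a\<^sup>2"
      using a by (simp add: C_def)
    have int_t: "integrable D (\<lambda>x. exp (t * x))"
      using int[of t] t a by simp
    have int_lin: "integrable D (\<lambda>x. 1 + t * x)"
      by (intro Bochner_Integration.integrable_add integrable_mult_right mean(1)) simp
    have int_E: "integrable D (\<lambda>x. t\<^sup>2 / a\<^sup>2 * ?E x)"
      by (intro integrable_mult_right int2)
    have lin: "(\<integral>x. 1 + t * x \<partial>D) = 1"
      using mean prob_space by simp
    have "(\<integral>x. exp (t * x) \<partial>D) \<le> (\<integral>x. (1 + t * x) + t\<^sup>2 / a\<^sup>2 * ?E x \<partial>D)"
      by (rule integral_mono[OF int_t Bochner_Integration.integrable_add[OF int_lin int_E] bound[OF t]])
    also have "\<dots> = (\<integral>x. 1 + t * x \<partial>D) + (\<integral>x. t\<^sup>2 / a\<^sup>2 * ?E x \<partial>D)"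
      by (rule Bochner_Integration.integral_add[OF int_lin int_E])
    also have "\<dots> = 1 + t\<^sup>2 / a\<^sup>2 * (C * a\<^sup>2)"
      unfolding lin integral_mult_right_zero E ..
    also have "\<dots> = 1 + C * t\<^sup>2"
      using a by simp
    also have "\<dots> \<le> exp (C * t\<^sup>2)"
      by (rule exp_ge_add_one_self)
    finally show ?thesis .
  qed
  then show thesis
    using a int by (intro that[of a C]) auto
qed

text \<open>The change splits into a normalisation error \<open>\<bar>1 - Z\<bar>\<close> and the
  pointwise error. As \<open>Z - 1\<close> is the average of \<open>exp Y - 1\<close> under
  \<open>p\<close>, the first is bounded by the second, whence the factor 2.\<close>

lemma tilted_weights_l1:
  fixes p Y :: "'a \<Rightarrow> real"
  assumes S: "finite S" and p: "\<And>s. s \<in> S \<Longrightarrow> 0 < p s" "sum p S = 1"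
  shows "(\<Sum>s\<in>S. \<bar>p s * exp (Y s) / (\<Sum>s\<in>S. p s * exp (Y s)) - p s\<bar>)
    \<le> 2 * (\<Sum>s\<in>S. p s * \<bar>exp (Y s) - 1\<bar>)"
proof -
  let ?Z = "\<Sum>s\<in>S. p s * exp (Y s)" and ?A = "\<Sum>s\<in>S. p s * \<bar>exp (Y s) - 1\<bar>"
  have "S \<noteq> {}"
    using p(2) by auto
  then have Z: "?Z > 0"
    using S p by (intro sum_pos) auto
  have "\<bar>p s * exp (Y s) / ?Z - p s\<bar> \<le> p s * exp (Y s) / ?Z * \<bar>1 - ?Z\<bar> + p s * \<bar>exp (Y s) - 1\<bar>"
    if "s \<in> S" for s
  proof -
    have "p s * exp (Y s) / ?Z - p s = p s * exp (Y s) / ?Z * (1 - ?Z) + p s * (exp (Y s) - 1)"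
      using Z by (simp add: field_simps)
    also have "\<bar>\<dots>\<bar> \<le> \<bar>p s * exp (Y s) / ?Z * (1 - ?Z)\<bar> + \<bar>p s * (exp (Y s) - 1)\<bar>"
      by (rule abs_triangle_ineq)
    also have "\<dots> = p s * exp (Y s) / ?Z * \<bar>1 - ?Z\<bar> + p s * \<bar>exp (Y s) - 1\<bar>"
      using p(1)[OF that] Z by (simp add: abs_mult)
    finally show ?thesis .
  qed
  then have "(\<Sum>s\<in>S. \<bar>p s * exp (Y s) / ?Z - p s\<bar>)
      \<le> (\<Sum>s\<in>S. p s * exp (Y s) / ?Z * \<bar>1 - ?Z\<bar> + p s * \<bar>exp (Y s) - 1\<bar>)"
    by (rule sum_mono)
  also have "\<dots> = \<bar>1 - ?Z\<bar> + ?A"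
    using Z by (simp add: sum.distrib sum_distrib_right[symmetric] sum_divide_distrib[symmetric])
  also have "1 - ?Z = (\<Sum>s\<in>S. p s * (1 - exp (Y s)))"
    using p(2) by (simp add: right_diff_distrib sum_subtractf)
  also have "\<bar>\<Sum>s\<in>S. p s * (1 - exp (Y s))\<bar> \<le> (\<Sum>s\<in>S. \<bar>p s * (1 - exp (Y s))\<bar>)"
    by (rule sum_abs)
  also have "\<dots> = ?A"
    using p(1) by (intro sum.cong refl) (simp add: abs_mult abs_minus_commute less_imp_le)
  finally show ?thesis by simp
qed

text \<open>The two replicas are exchanged one at a time, each at the cost of one single-replica
  distance.\<close>

lemma product_weights_l1:
  fixes p q :: "'a \<Rightarrow> real"
  assumes p: "\<And>s. s \<in> S \<Longrightarrow> 0 \<le> p s" "sum p S = 1" and q: "\<And>s. s \<in> S \<Longrightarrow> 0 \<le> q s" "sum q S = 1"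
  shows "(\<Sum>s\<in>S. \<Sum>t\<in>S. \<bar>q s * q t - p s * p t\<bar>) \<le> 2 * (\<Sum>s\<in>S. \<bar>q s - p s\<bar>)"
proof -
  have "\<bar>q s * q t - p s * p t\<bar> \<le> q s * \<bar>q t - p t\<bar> + \<bar>q s - p s\<bar> * p t" if "s \<in> S" "t \<in> S" for s t
  proof -
    have "q s * q t - p s * p t = q s * (q t - p t) + (q s - p s) * p t"
      by (simp add: algebra_simps)
    also have "\<bar>\<dots>\<bar> \<le> \<bar>q s * (q t - p t)\<bar> + \<bar>(q s - p s) * p t\<bar>"
      by (rule abs_triangle_ineq)
    finally show ?thesis
      using p q that by (simp add: abs_mult)
  qed
  then have "(\<Sum>s\<in>S. \<Sum>t\<in>S. \<bar>q s * q t - p s * p t\<bar>)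
      \<le> (\<Sum>s\<in>S. \<Sum>t\<in>S. q s * \<bar>q t - p t\<bar> + \<bar>q s - p s\<bar> * p t)"
    by (intro sum_mono)
  also have "\<dots> = 2 * (\<Sum>s\<in>S. \<bar>q s - p s\<bar>)"
    by (simp add: sum.distrib sum_product[symmetric] p q)
  finally show ?thesis .
qed

text \<open>This is \<open>- \<beta>\<close> times the random-field part of
  \<open>hamiltonian\<close>, so the Gibbs weight is the Ising weight times its exponential.\<close>

definition field_energy :: "nat \<Rightarrow> real \<Rightarrow> nat \<Rightarrow> real \<Rightarrow> (int list \<Rightarrow> real) \<Rightarrow> (int list \<Rightarrow> real) \<Rightarrow> real" where
  "field_energy d \<beta> n h J \<sigma> = \<beta> * h / sqrt (card (box d n)) * (\<Sum>i\<in>box d n. J i * \<sigma> i)"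

text \<open>The average is over the Ising measure, which does not depend on \<open>J\<close>. The
  disorder expectation can thus be taken inside the sum, for each fixed
  \<open>\<sigma>\<close>.\<close>

definition tilt_error :: "nat \<Rightarrow> real \<Rightarrow> nat \<Rightarrow> real \<Rightarrow> (int list \<Rightarrow> real) \<Rightarrow> real" where
  "tilt_error d \<beta> n h J = (\<Sum>\<sigma>\<in>configs d n. gibbs d \<beta> n 0 (\<lambda>_. 0) \<sigma> * \<bar>exp (field_energy d \<beta> n h J \<sigma>) - 1\<bar>)"

lemma tilt_error_nonneg: "0 \<le> tilt_error d \<beta> n h J"
  unfolding tilt_error_def by (intro sum_nonneg mult_nonneg_nonneg less_imp_le[OF gibbs_pos]) auto

text \<open>The Ising partition function cancels in the quotient, leaving the shape treated by
  \<open>tilted_weights_l1\<close>.\<close>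

lemma gibbs_tilt:
  "gibbs d \<beta> n h J \<sigma> = gibbs d \<beta> n 0 (\<lambda>_. 0) \<sigma> * exp (field_energy d \<beta> n h J \<sigma>)
     / (\<Sum>\<sigma>\<in>configs d n. gibbs d \<beta> n 0 (\<lambda>_. 0) \<sigma> * exp (field_energy d \<beta> n h J \<sigma>))"
proof -
  let ?H0 = "hamiltonian d n 0 (\<lambda>_. 0)" and ?Y = "field_energy d \<beta> n h J"
  have w: "exp (- \<beta> * hamiltonian d n h J \<sigma>) = exp (- \<beta> * ?H0 \<sigma>) * exp (?Y \<sigma>)" for \<sigma>
    by (simp add: hamiltonian_def field_energy_def exp_add[symmetric] algebra_simps)
  have "gibbs d \<beta> n 0 (\<lambda>_. 0) \<sigma> * exp (?Y \<sigma>) = exp (- \<beta> * hamiltonian d n h J \<sigma>) / partition_fn d \<beta> n 0 (\<lambda>_. 0)" for \<sigma>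
    unfolding w by (simp add: gibbs_def)
  note tilt = this
  have "(\<Sum>\<sigma>\<in>configs d n. gibbs d \<beta> n 0 (\<lambda>_. 0) \<sigma> * exp (?Y \<sigma>)) = partition_fn d \<beta> n h J / partition_fn d \<beta> n 0 (\<lambda>_. 0)"
    unfolding tilt by (simp only: sum_divide_distrib[symmetric] partition_fn_def[of d \<beta> n h J])
  then show ?thesis
    using partition_fn_pos[of d \<beta> n 0 "\<lambda>_. 0"] unfolding tilt by (simp add: gibbs_def)
qed

text \<open>One factor 2 comes from the two replicas, the other from the normalisation of the tilt;
  the bound is uniform in \<open>x\<close>.\<close>

lemma cdf_overlap_law_close:
  "\<bar>cdf (overlap_law d \<beta> n h J) x - cdf (ising_overlap_law d \<beta> n) x\<bar> \<le> 4 * tilt_error d \<beta> n h J"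
proof -
  let ?C = "configs d n" and ?p = "gibbs d \<beta> n 0 (\<lambda>_. 0)" and ?q = "gibbs d \<beta> n h J"
  let ?I = "\<lambda>a b. indicator {..x} (overlap d n a b) :: real"
  have "\<bar>cdf (overlap_law d \<beta> n h J) x - cdf (ising_overlap_law d \<beta> n) x\<bar>
      = \<bar>\<Sum>a\<in>?C. \<Sum>b\<in>?C. (?q a * ?q b - ?p a * ?p b) * ?I a b\<bar>"
    unfolding ising_overlap_law_def cdf_overlap_law gibbs2_def
    by (simp only: sum_subtractf left_diff_distrib)
  also have "\<dots> \<le> (\<Sum>a\<in>?C. \<Sum>b\<in>?C. \<bar>(?q a * ?q b - ?p a * ?p b) * ?I a b\<bar>)"
    by (intro order.trans[OF sum_abs] sum_mono sum_abs)
  also have "\<dots> \<le> (\<Sum>a\<in>?C. \<Sum>b\<in>?C. \<bar>?q a * ?q b - ?p a * ?p b\<bar>)"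
    by (intro sum_mono) (auto simp: indicator_def)
  also have "\<dots> \<le> 2 * (\<Sum>a\<in>?C. \<bar>?q a - ?p a\<bar>)"
    by (intro product_weights_l1 sum_gibbs less_imp_le[OF gibbs_pos])
  also have "(\<Sum>a\<in>?C. \<bar>?q a - ?p a\<bar>) \<le> 2 * tilt_error d \<beta> n h J"
    unfolding gibbs_tilt[of d \<beta> n h J] tilt_error_def
    by (intro tilted_weights_l1 finite_configs gibbs_pos sum_gibbs)
  finally show ?thesis by simp
qed

lemma (in prob_space) expectation_abs_le_sqrt:
  fixes X :: "'a \<Rightarrow> real"
  assumes X: "random_variable borel X" and sq: "integrable M (\<lambda>x. (X x)\<^sup>2)"
  shows "integrable M X" "expectation (\<lambda>x. \<bar>X x\<bar>) \<le> sqrt (expectation (\<lambda>x. (X x)\<^sup>2))"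
proof -
  show X': "integrable M X"
    using X sq by (rule square_integrable_imp_integrable)
  have "(expectation (\<lambda>x. \<bar>X x\<bar>))\<^sup>2 \<le> expectation (\<lambda>x. (X x)\<^sup>2)"
    using variance_eq[of "\<lambda>x. \<bar>X x\<bar>"] variance_positive[of "\<lambda>x. \<bar>X x\<bar>"] X' sq by simp
  then show "expectation (\<lambda>x. \<bar>X x\<bar>) \<le> sqrt (expectation (\<lambda>x. (X x)\<^sup>2))"
    by (rule real_le_rsqrt)
qed

text \<open>For fixed \<open>\<sigma>\<close> the exponential moment factorises over sites. The
  squared site coefficients are of order \<open>1 / N\<close> because spins square to 1, so the
  \<open>N\<close> factors combine to a bound free of \<open>N\<close>. The moment with
  \<open>k = 2\<close> produces the constant 4, and the first moment is at least 1.\<close>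

lemma expectation_tilt_error_le:
  fixes D :: "real measure"
  assumes D: "real_distribution D"
    and mean: "integrable D (\<lambda>x. x)" "(\<integral>x. x \<partial>D) = 0"
    and mgf: "\<And>t. \<bar>t\<bar> \<le> a \<Longrightarrow> integrable D (\<lambda>x. exp (t * x))"
      "\<And>t. \<bar>t\<bar> \<le> a \<Longrightarrow> (\<integral>x. exp (t * x) \<partial>D) \<le> exp (C * t\<^sup>2)"
    and small: "\<bar>2 * \<beta> * h\<bar> \<le> a"
  shows "integrable (disorder d n D) (tilt_error d \<beta> n h)"
    "(\<integral>J. tilt_error d \<beta> n h J \<partial>disorder d n D) \<le> sqrt (exp (4 * C * \<beta>\<^sup>2 * h\<^sup>2) - 1)"
proof -
  let ?P = "disorder d n D" and ?V = "box d n" and ?Y = "field_energy d \<beta> n h"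
  define N where "N = real (card ?V)"
  interpret D: real_distribution D by fact
  interpret product_sigma_finite "\<lambda>_ :: int list. D" by standard
  interpret P: prob_space ?P by (rule prob_space_disorder) (rule D.prob_space_axioms)
  have N: "N \<ge> 1"
    using card_box_pos[of d n] by (simp add: N_def Suc_le_eq[symmetric])
  \<comment> \<open>Since \<open>N\<close> is at least 1, the scaling only shrinks the coefficient;
    the 2 in \<open>small\<close> leaves room for \<open>k = 2\<close>.\<close>
  have s: "\<bar>\<beta> * h / sqrt N\<bar> \<le> \<bar>\<beta> * h\<bar>"
    using N by (simp add: divide_le_eq mult_right_mono mult_le_cancel_left1)
  have exps: "integrable ?P (\<lambda>J. exp (k * ?Y J \<sigma>))" "(\<integral>J. exp (k * ?Y J \<sigma>) \<partial>?P) \<le> exp (C * k\<^sup>2 * \<beta>\<^sup>2 * h\<^sup>2)"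
    if k: "\<bar>k\<bar> \<le> 2" and \<sigma>: "\<sigma> \<in> configs d n" for k \<sigma>
  proof -
    define t where "t i = k * (\<beta> * h / sqrt N) * \<sigma> i" for i
    have t: "\<bar>t i\<bar> \<le> a" if "i \<in> ?V" for i
    proof -
      have "\<bar>t i\<bar> = \<bar>k\<bar> * \<bar>\<beta> * h / sqrt N\<bar>"
        using configs_spin[OF \<sigma> that] by (auto simp: t_def abs_mult)
      also have "\<dots> \<le> 2 * \<bar>\<beta> * h\<bar>"
        using k s by (intro mult_mono) auto
      finally show ?thesis
        using small by (simp add: abs_mult)
    qed
    have prod: "exp (k * ?Y J \<sigma>) = (\<Prod>i\<in>?V. exp (t i * J i))" for J
      by (simp add: exp_sum[symmetric] field_energy_def t_def N_def sum_distrib_left sum_divide_distrib mult_ac)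
    show "integrable ?P (\<lambda>J. exp (k * ?Y J \<sigma>))"
      unfolding prod disorder_def using t by (intro product_integrable_prod mgf) auto
    have "(\<integral>J. exp (k * ?Y J \<sigma>) \<partial>?P) = (\<Prod>i\<in>?V. \<integral>x. exp (t i * x) \<partial>D)"
      unfolding prod disorder_def using t by (intro product_integral_prod mgf) auto
    also have "\<dots> \<le> (\<Prod>i\<in>?V. exp (C * (t i)\<^sup>2))"
      using t by (intro prod_mono conjI mgf integral_nonneg_AE) auto
    also have "\<dots> = (\<Prod>i\<in>?V. exp (C * k\<^sup>2 * \<beta>\<^sup>2 * h\<^sup>2 / N))"
    proof (intro prod.cong refl arg_cong[where f=exp])
      fix i assume "i \<in> ?V"
      then have "(\<sigma> i)\<^sup>2 = 1"
        using configs_spin[OF \<sigma>, of i] by auto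
      then show "C * (t i)\<^sup>2 = C * k\<^sup>2 * \<beta>\<^sup>2 * h\<^sup>2 / N"
        using N by (simp add: t_def power_mult_distrib power_divide)
    qed
    also have "\<dots> = exp (C * k\<^sup>2 * \<beta>\<^sup>2 * h\<^sup>2)"
      using N by (simp add: exp_of_nat_mult[symmetric] N_def del: card_0_eq)
    finally show "(\<integral>J. exp (k * ?Y J \<sigma>) \<partial>?P) \<le> exp (C * k\<^sup>2 * \<beta>\<^sup>2 * h\<^sup>2)" .
  qed
  have Y: "integrable ?P (\<lambda>J. ?Y J \<sigma>)" "(\<integral>J. ?Y J \<sigma> \<partial>?P) = 0" for \<sigma>
  proof -
    have "integrable ?P (\<lambda>J. J i)" "(\<integral>J. J i \<partial>?P) = 0" if "i \<in> ?V" for i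
      using integral_PiM_component[of "\<lambda>_. D" ?V i "\<lambda>x. x"] that mean D.prob_space_axioms
      by (auto simp: disorder_def)
    then show "integrable ?P (\<lambda>J. ?Y J \<sigma>)" "(\<integral>J. ?Y J \<sigma> \<partial>?P) = 0"
      unfolding field_energy_def by auto
  qed
  have err: "integrable ?P (\<lambda>J. exp (?Y J \<sigma>) - 1)"
    "(\<integral>J. \<bar>exp (?Y J \<sigma>) - 1\<bar> \<partial>?P) \<le> sqrt (exp (4 * C * \<beta>\<^sup>2 * h\<^sup>2) - 1)" if \<sigma>: "\<sigma> \<in> configs d n" for \<sigma>
  proof -
    note e1 = exps[of 1 \<sigma>, simplified, OF \<sigma>] and e2 = exps[of 2 \<sigma>, simplified, OF \<sigma>]
    show i1: "integrable ?P (\<lambda>J. exp (?Y J \<sigma>) - 1)"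
      using e1 by simp
    have sq: "(exp (?Y J \<sigma>) - 1)\<^sup>2 = exp (2 * ?Y J \<sigma>) - 2 * exp (?Y J \<sigma>) + 1" for J
      by (simp add: power2_diff exp_double)
    \<comment> \<open>Jensen's inequality in its tangent-line form, using that the field energy has
      mean zero.\<close>
    have "(\<integral>J. 1 + ?Y J \<sigma> \<partial>?P) \<le> (\<integral>J. exp (?Y J \<sigma>) \<partial>?P)"
      using Y e1 by (intro integral_mono exp_ge_add_one_self) auto
    then have ge1: "1 \<le> (\<integral>J. exp (?Y J \<sigma>) \<partial>?P)"
      using Y by (simp add: P.prob_space)
    have i2: "integrable ?P (\<lambda>J. (exp (?Y J \<sigma>) - 1)\<^sup>2)"
      unfolding sq using e1 e2 by simp
    have "(\<integral>J. \<bar>exp (?Y J \<sigma>) - 1\<bar> \<partial>?P) \<le> sqrt (\<integral>J. (exp (?Y J \<sigma>) - 1)\<^sup>2 \<partial>?P)"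
      by (rule P.expectation_abs_le_sqrt(2)[OF borel_measurable_integrable[OF i1] i2])
    also have "(\<integral>J. (exp (?Y J \<sigma>) - 1)\<^sup>2 \<partial>?P)
        = (\<integral>J. exp (2 * ?Y J \<sigma>) \<partial>?P) - 2 * (\<integral>J. exp (?Y J \<sigma>) \<partial>?P) + 1"
      unfolding sq using e1 e2 by (simp add: P.prob_space)
    also have "sqrt \<dots> \<le> sqrt (exp (4 * C * \<beta>\<^sup>2 * h\<^sup>2) - 1)"
      using ge1 e2 by (simp add: mult_ac)
    finally show "(\<integral>J. \<bar>exp (?Y J \<sigma>) - 1\<bar> \<partial>?P) \<le> sqrt (exp (4 * C * \<beta>\<^sup>2 * h\<^sup>2) - 1)"
      by simp
  qed
  show "integrable ?P (tilt_error d \<beta> n h)"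
    unfolding tilt_error_def using err by (intro Bochner_Integration.integrable_sum integrable_mult_right integrable_abs)
  have "(\<integral>J. tilt_error d \<beta> n h J \<partial>?P)
      = (\<Sum>\<sigma>\<in>configs d n. gibbs d \<beta> n 0 (\<lambda>_. 0) \<sigma> * (\<integral>J. \<bar>exp (?Y J \<sigma>) - 1\<bar> \<partial>?P))"
    unfolding tilt_error_def using err
    by (subst Bochner_Integration.integral_sum) (auto intro!: integrable_mult_right)
  also have "\<dots> \<le> (\<Sum>\<sigma>\<in>configs d n. gibbs d \<beta> n 0 (\<lambda>_. 0) \<sigma> * sqrt (exp (4 * C * \<beta>\<^sup>2 * h\<^sup>2) - 1))"
    by (intro sum_mono mult_left_mono err less_imp_le[OF gibbs_pos])
  also have "\<dots> = sqrt (exp (4 * C * \<beta>\<^sup>2 * h\<^sup>2) - 1)"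
    by (simp add: sum_distrib_right[symmetric] sum_gibbs)
  finally show "(\<integral>J. tilt_error d \<beta> n h J \<partial>?P) \<le> sqrt (exp (4 * C * \<beta>\<^sup>2 * h\<^sup>2) - 1)" .
qed

section \<open>The limits for vanishing and for diverging field\<close>

theorem overlap_law_dist_tendsto_in_probability:
  fixes D :: "real measure"
  assumes D: "real_distribution D"
    and mean: "integrable D (\<lambda>x. x)" "(\<integral>x. x \<partial>D) = 0"
    and mgf: "\<delta> > 0" "\<And>t. \<bar>t\<bar> < \<delta> \<Longrightarrow> integrable D (\<lambda>x. exp (t * x))"
    and h: "h \<longlonglongrightarrow> 0" and \<rho>: "metrizes_weak_conv \<rho>" and \<epsilon>: "\<epsilon> > 0"
  shows "(\<lambda>n. measure (disorder d n D) {J \<in> space (disorder d n D).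
    \<rho> (overlap_law d \<beta> n (h n) J) (ising_overlap_law d \<beta> n) > \<epsilon>}) \<longlonglongrightarrow> 0"
proof -
  interpret D: real_distribution D by fact
  obtain a C where a: "a > 0" and aC: "\<And>t. \<bar>t\<bar> \<le> a \<Longrightarrow> integrable D (\<lambda>x. exp (t * x))"
    "\<And>t. \<bar>t\<bar> \<le> a \<Longrightarrow> (\<integral>x. exp (t * x) \<partial>D) \<le> exp (C * t\<^sup>2)"
    using subgaussian_mgf_near_zero[OF D mean mgf] by metis
  obtain \<eta> where \<eta>: "\<eta> > 0" and unif: "\<And>\<mu> \<nu>. real_distribution \<mu> \<Longrightarrow> real_distribution \<nu> \<Longrightarrow>
      measure \<nu> {-2<..1} = 1 \<Longrightarrow> (\<And>x. \<bar>cdf \<mu> x - cdf \<nu> x\<bar> \<le> \<eta>) \<Longrightarrow> \<rho> \<mu> \<nu> \<le> \<epsilon>"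
    using metrizes_weak_conv_uniform[OF \<rho> \<epsilon>, of "-2" 1] by auto
  have "(\<lambda>n. \<bar>2 * \<beta> * h n\<bar>) \<longlonglongrightarrow> \<bar>2 * \<beta> * 0\<bar>"
    by (intro tendsto_intros h)
  then have "\<forall>\<^sub>F n in sequentially. \<bar>2 * \<beta> * h n\<bar> < a"
    using a by (intro order_tendstoD) auto
  then have upper: "\<forall>\<^sub>F n in sequentially. measure (disorder d n D) {J \<in> space (disorder d n D).
      \<rho> (overlap_law d \<beta> n (h n) J) (ising_overlap_law d \<beta> n) > \<epsilon>}
    \<le> sqrt (exp (4 * C * \<beta>\<^sup>2 * (h n)\<^sup>2) - 1) / (\<eta> / 4)"
  proof eventually_elim
    fix n assume small: "\<bar>2 * \<beta> * h n\<bar> < a"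
    let ?P = "disorder d n D" and ?e = "tilt_error d \<beta> n (h n)"
    interpret P: prob_space ?P by (rule prob_space_disorder) (rule D.prob_space_axioms)
    note e = expectation_tilt_error_le[OF D mean aC less_imp_le[OF small], of d n]
    have [measurable]: "?e \<in> borel_measurable ?P"
      using e(1) by simp
    \<comment> \<open>If the tilt error is below \<open>\<eta> / 4\<close>, the distribution
      functions differ by at most \<open>\<eta>\<close>, the 4 being that of
      \<open>cdf_overlap_law_close\<close>, and the distance is at most \<open>\<epsilon>\<close>.
      Markov's inequality then controls the remaining event.\<close>
    have "measure ?P {J \<in> space ?P. \<rho> (overlap_law d \<beta> n (h n) J) (ising_overlap_law d \<beta> n) > \<epsilon>}
        \<le> measure ?P {J \<in> space ?P. \<eta> / 4 \<le> ?e J}"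
    proof (intro P.finite_measure_mono subsetI CollectI conjI)
      fix J assume J: "J \<in> {J \<in> space ?P. \<rho> (overlap_law d \<beta> n (h n) J) (ising_overlap_law d \<beta> n) > \<epsilon>}"
      show "\<eta> / 4 \<le> ?e J"
      proof (rule ccontr)
        assume "\<not> \<eta> / 4 \<le> ?e J"
        then have "\<bar>cdf (overlap_law d \<beta> n (h n) J) x - cdf (ising_overlap_law d \<beta> n) x\<bar> \<le> \<eta>" for x
          using cdf_overlap_law_close[of d \<beta> n "h n" J x] by linarith
        then have "\<rho> (overlap_law d \<beta> n (h n) J) (ising_overlap_law d \<beta> n) \<le> \<epsilon>"
          unfolding ising_overlap_law_def
          by (intro unif real_distribution_overlap_law measure_overlap_law_support)
        then show False
          using J by simp
      qed
    qed auto
    also have "\<dots> \<le> (\<integral>J. ?e J \<partial>?P) / (\<eta> / 4)"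
      using \<eta> e(1) by (intro integral_Markov_inequality_measure[where A="{}"] always_eventually)
        (auto simp: tilt_error_nonneg)
    also have "\<dots> \<le> sqrt (exp (4 * C * \<beta>\<^sup>2 * (h n)\<^sup>2) - 1) / (\<eta> / 4)"
      using \<eta> by (intro divide_right_mono e) auto
    finally show "measure ?P {J \<in> space ?P. \<rho> (overlap_law d \<beta> n (h n) J) (ising_overlap_law d \<beta> n) > \<epsilon>}
      \<le> sqrt (exp (4 * C * \<beta>\<^sup>2 * (h n)\<^sup>2) - 1) / (\<eta> / 4)" .
  qed
  have "(\<lambda>n. sqrt (exp (4 * C * \<beta>\<^sup>2 * (h n)\<^sup>2) - 1) / (\<eta> / 4)) \<longlonglongrightarrow> sqrt (exp (4 * C * \<beta>\<^sup>2 * 0\<^sup>2) - 1) / (\<eta> / 4)"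
    using \<eta> by (intro tendsto_intros h) auto
  then have lim: "(\<lambda>n. sqrt (exp (4 * C * \<beta>\<^sup>2 * (h n)\<^sup>2) - 1) / (\<eta> / 4)) \<longlonglongrightarrow> 0"
    by simp
  show ?thesis
    by (rule tendsto_sandwich[OF _ upper tendsto_const lim]) simp
qed

theorem overlap_variance_tendsto:
  assumes "\<beta> > 0" and h: "filterlim (\<lambda>n. \<bar>h n\<bar>) at_top sequentially"
  shows "(\<lambda>n. \<integral>J. overlap_variance d \<beta> n (h n) J \<partial>disorder d n std_gaussian) \<longlonglongrightarrow> 0"
proof (rule tendsto_sandwich[OF always_eventually _ tendsto_const])
  show "\<forall>n. 0 \<le> (\<integral>J. overlap_variance d \<beta> n (h n) J \<partial>disorder d n std_gaussian)"
    by (intro allI integral_nonneg_AE always_eventually overlap_variance_bounds)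
  have "\<forall>\<^sub>F n in sequentially. \<bar>h n\<bar> > 0"
    using h unfolding filterlim_at_top_dense by (rule spec)
  then show "\<forall>\<^sub>F n in sequentially. (\<integral>J. overlap_variance d \<beta> n (h n) J \<partial>disorder d n std_gaussian)
      \<le> 2 / (\<beta> * \<bar>h n\<bar>)"
    by eventually_elim (use assms in \<open>auto intro!: expectation_overlap_variance_le\<close>)
  show "(\<lambda>n. 2 / (\<beta> * \<bar>h n\<bar>)) \<longlonglongrightarrow> 0"
    using assms by (intro tendsto_divide_0[OF tendsto_const] filterlim_at_top_imp_at_infinity
      filterlim_tendsto_pos_mult_at_top[OF tendsto_const])
qed

text \<open>The measurability and integrability clauses guard against default values:
  \<open>measure\<close> is 0 on a non-measurable set and the Bochner integral of a non-integrable
  function is 0, so without these clauses the limits could hold vacuously.\<close>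

theorem theorem2p8:
  fixes d :: nat and \<beta> :: real
  assumes "d \<ge> 2" and "\<beta> > 0"
  shows
   "(\<forall>(h :: nat \<Rightarrow> real) (D :: real measure) (\<rho> :: real measure \<Rightarrow> real measure \<Rightarrow> real).
       real_distribution D
     \<and> integrable D (\<lambda>x. x) \<and> (\<integral>x. x \<partial>D) = 0
     \<and> integrable D (\<lambda>x. x\<^sup>2) \<and> (\<integral>x. x\<^sup>2 \<partial>D) = 1
     \<and> (\<exists>\<delta>>0. \<forall>t. \<bar>t\<bar> < \<delta> \<longrightarrow> integrable D (\<lambda>x. exp (t * x)))
     \<and> h \<longlonglongrightarrow> 0
     \<and> metrizes_weak_conv \<rho>
     \<longrightarrow> (\<forall>\<epsilon>>0.
           (\<forall>n. {J \<in> space (disorder d n D).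
                  \<rho> (overlap_law d \<beta> n (h n) J) (ising_overlap_law d \<beta> n) > \<epsilon>}
                \<in> sets (disorder d n D))
         \<and> (\<lambda>n. measure (disorder d n D)
                  {J \<in> space (disorder d n D).
                     \<rho> (overlap_law d \<beta> n (h n) J) (ising_overlap_law d \<beta> n) > \<epsilon>})
             \<longlonglongrightarrow> 0))
  \<and> (\<forall>h :: nat \<Rightarrow> real.
       filterlim (\<lambda>n. \<bar>h n\<bar>) at_top sequentially
     \<longrightarrow> (\<forall>n. integrable (disorder d n std_gaussian)
              (\<lambda>J. gibbs2 d \<beta> n (h n) J
                     (\<lambda>\<sigma>1 \<sigma>2. (overlap d n \<sigma>1 \<sigma>2
                        - gibbs2 d \<beta> n (h n) J (overlap d n))\<^sup>2)))
       \<and> (\<lambda>n. \<integral>J. gibbs2 d \<beta> n (h n) J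
                     (\<lambda>\<sigma>1 \<sigma>2. (overlap d n \<sigma>1 \<sigma>2
                        - gibbs2 d \<beta> n (h n) J (overlap d n))\<^sup>2)
                  \<partial>disorder d n std_gaussian) \<longlonglongrightarrow> 0)"
proof (intro conjI allI impI; (elim conjE exE)?)
  fix h :: "nat \<Rightarrow> real" and D :: "real measure" and \<rho> and \<epsilon> :: real and n
  assume D: "real_distribution D" and \<rho>: "metrizes_weak_conv \<rho>"
  interpret real_distribution D by fact
  show "{J \<in> space (disorder d n D). \<rho> (overlap_law d \<beta> n (h n) J) (ising_overlap_law d \<beta> n) > \<epsilon>}
      \<in> sets (disorder d n D)"
    unfolding ising_overlap_law_def
    by (rule borel_measurable_less[OF borel_measurable_const overlap_law_dist_measurable])
      (simp_all add: \<rho> real_distribution_overlap_law)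
next
  fix h :: "nat \<Rightarrow> real" and D :: "real measure" and \<rho> and \<epsilon> \<delta> :: real
  assume D: "real_distribution D" and mean: "integrable D (\<lambda>x. x)" "(\<integral>x. x \<partial>D) = 0"
    and \<delta>: "\<delta> > 0" and mgf: "\<forall>t. \<bar>t\<bar> < \<delta> \<longrightarrow> integrable D (\<lambda>x. exp (t * x))"
    and h: "h \<longlonglongrightarrow> 0" and \<rho>: "metrizes_weak_conv \<rho>" and \<epsilon>: "\<epsilon> > 0"
  show "(\<lambda>n. measure (disorder d n D) {J \<in> space (disorder d n D).
      \<rho> (overlap_law d \<beta> n (h n) J) (ising_overlap_law d \<beta> n) > \<epsilon>}) \<longlonglongrightarrow> 0"
    by (rule overlap_law_dist_tendsto_in_probability[OF D mean \<delta> mgf[rule_format] h \<rho> \<epsilon>])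
next
  fix h :: "nat \<Rightarrow> real" and n
  show "integrable (disorder d n std_gaussian) (overlap_variance d \<beta> n (h n))"
    by (intro integrable_overlap_variance prob_space_std_gaussian sets_std_gaussian)
next
  fix h :: "nat \<Rightarrow> real"
  assume "filterlim (\<lambda>n. \<bar>h n\<bar>) at_top sequentially"
  then show "(\<lambda>n. \<integral>J. overlap_variance d \<beta> n (h n) J \<partial>disorder d n std_gaussian) \<longlonglongrightarrow> 0"
    by (rule overlap_variance_tendsto[OF assms(2)])
qed

end
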